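(* Let $\alpha,\beta>-1$, $0<k<\beta+1$, $\ell\in\mathbb N$, and let $D$, $E$ and $W$ be the differential operators and the weight matrix given in the context. For each $w\in\mathbb N_0$ let $P_w(u)$ be the $(\ell+1)\times(\ell+1)$ matrix valued polynomial whose rows are the vectors $P_w^j(u)$, $j=0,\dots,\ell$, constructed in the context (i.e. the columns of $P_w^*(u)$ are $P_w^0(u),\dots,P_w^\ell(u)$). Then for all $w\in\mathbb N_0$ $$EP_w^*(u)=P_w^*(u)\Lambda_w(E),\qquad\Lambda_w(E)=\sum_{0\le j\le\ell}\mu_j(w)E_{jj},$$ where $$\mu_j(w)=-w(w+\alpha+\beta+\ell+j+1)(\alpha-\ell+3j)-j(j+\alpha+\beta-k+1)(\alpha+2\ell+3k).$$
   Context: Matrices are $(\ell+1)\times(\ell+1)$ with rows and columns indexed by $0,\dots,\ell$; $E_{ij}$ is the matrix with $(i,j)$ entry $1$ and all other entries $0$; terms with an index outside $\{0,\dots,\ell\}$ (whose coefficients vanish) are zero. $\mathbb N=\{1,2,\dots\}$, $\mathbb N_0=\mathbb N\cup\{0\}$; $(z)_r=z(z+1)\cdots(z+r-1)$, $(z)_0=1$; $\binom{x}{m}=x(x-1)\cdots(x-m+1)/m!$ for real $x$ and $m\in\mathbb N_0$. $A^*$ is the conjugate transpose and $P^*(u)=P(u)^*$ for real $u$. Differential operators act on vector or matrix valued functions with coefficients multiplying on the left. $$D=u(1-u)\frac{d^2}{du^2}+(C-uU)\frac{d}{du}-V,$$ $$E=(1-u)(Q_0+uQ_1)\frac{d^2}{du^2}+(P_0+uP_1)\frac{d}{du}-(\alpha+2\ell+3k)V,$$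 where (here $P_0,P_1,Q_0,Q_1$ are constant matrices, not to be confused with the polynomials $P_w$) $$C=\sum_{i=0}^\ell(\beta+1+2i)E_{ii}+\sum_{i=1}^\ell iE_{i,i-1},\qquad U=\sum_{i=0}^\ell(\alpha+\beta+\ell+i+2)E_{ii},$$ $$V=\sum_{i=0}^\ell i(\alpha+\beta-k+1+i)E_{ii}-\sum_{i=0}^{\ell-1}(\ell-i)(\beta-k+1+i)E_{i,i+1},$$ $$Q_0=\sum_{i=0}^\ell3iE_{i,i-1},\qquad Q_1=\sum_{i=0}^\ell(\alpha-\ell+3i)E_{ii},$$ $$P_0=\sum_{i=0}^\ell\big((\alpha+2\ell)(\beta+1+2i)-3k(\ell-i)-3i(\beta-k+i)\big)E_{ii}-\sum_{i=0}^\ell i(3i+3\beta-3k+3+\ell+2\alpha)E_{i,i-1},$$ $$P_1=-\sum_{i=0}^\ell(\alpha-\ell+3i)(\alpha+\beta+\ell+i+2)E_{ii}+\sum_{i=0}^\ell3(\beta-k+1+i)(\ell-i)E_{i,i+1}.$$ The weight is $W(u)=(1-u)^\alpha u^\beta Z(u)$ on $(0,1)$, with $$Z(u)=\sum_{i,j=0}^\ell\Big(\sum_{r=0}^\ell\binom ri\binom rj\binom{\ell+k-r-1}{\ell-r}\binom{\beta-k+r}{r}(1-u)^{\ell-r}u^{i+j}\Big)E_{ij}.$$ Two $\mathbb C^{\ell+1}$-valued polynomials (column vectors) $F,G$ are orthogonal if $\int_0^1G(u)^*W(u)F(u)\,du=0$. For $w\in\mathbb N_0$, $0\le j\le\ell$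 put $$\lambda_j(w)=-w(w+\alpha+\beta+\ell+j+1)-j(j+\alpha+\beta-k+1).$$ For $\lambda\in\mathbb C$ define $[C;U;V+\lambda]_0=I$ and $[C;U;V+\lambda]_{i+1}=(C+i)^{-1}\big(i(U+i-1)+V+\lambda\big)[C;U;V+\lambda]_i$ (scalars denote multiples of the identity). Let $V(\lambda)$ be the space of all $\mathbb C^{\ell+1}$-valued polynomials $P$ with $DP=\lambda P$. Construction of $P_w^j$: (1) If $\lambda=\lambda_j(w)$ is not repeated, i.e. $\lambda_{j'}(w')\neq\lambda$ for all $(w',j')\ne(w,j)$, let $F_0\in\mathbb C^{\ell+1}$ be the unique vector with $$[C;U;V+\lambda_j(w)]_wF_0=\sum_{0\le i\le j}(-1)^{i+j}\binom{\ell-i}{\ell-j}\frac{(\beta-k+1+i)_{j-i}}{(\alpha+\beta+j+i+w-k+1)_{j-i}}\,e_i,$$ where $e_0,\dots,e_\ell$ is the canonical basis, and let $P_w^j(u)=\sum_{i\ge0}\frac{u^i}{i!}[C;U;V+\lambda_j(w)]_iF_0$ (which is a polynomial). (2) If $\lambda$ is repeated, list all pairs $(w_1,j_1),\dots,(w_s,j_s)$ with $\lambda_{j_r}(w_r)=\lambda$, ordered so that $w_1<w_2<\dots<w_s$ (the $w_r$ are distinct). Put $V_r=\{P\in V(\lambda):\deg P\le w_r\}$ and $V_0=\{0\}$. For each $1\le r\le s$ let $P_{w_r}^{j_r}$ be a nonzero element of $V_r$ orthogonal to $V_{r-1}$. *)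

theory Defs
  imports
    "HOL-Analysis.Henstock_Kurzweil_Integration"
    "Jordan_Normal_Form.Gauss_Jordan_Elimination"
    "HOL-Computational_Algebra.Polynomial"
begin

definition real_mat :: "nat \<Rightarrow> (nat \<Rightarrow> nat \<Rightarrow> real) \<Rightarrow> complex mat" where
  "real_mat l f = mat (l + 1) (l + 1) (\<lambda>(i, j). complex_of_real (f i j))"

definition matC :: "real \<Rightarrow> nat \<Rightarrow> complex mat" where
  "matC \<beta> l = real_mat l (\<lambda>i j.
     if j = i then \<beta> + 1 + 2 * real i
     else if i = j + 1 then real i
     else 0)"

definition matU :: "real \<Rightarrow> real \<Rightarrow> nat \<Rightarrow> complex mat" where
  "matU \<alpha> \<beta> l = real_mat l (\<lambda>i j.
     if j = i then \<alpha> + \<beta> + real l + real i + 2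
     else 0)"

definition matV :: "real \<Rightarrow> real \<Rightarrow> real \<Rightarrow> nat \<Rightarrow> complex mat" where
  "matV \<alpha> \<beta> k l = real_mat l (\<lambda>i j.
     if j = i then real i * (\<alpha> + \<beta> - k + 1 + real i)
     else if j = i + 1 then - ((real l - real i) * (\<beta> - k + 1 + real i))
     else 0)"

definition matQ0 :: "nat \<Rightarrow> complex mat" where
  "matQ0 l = real_mat l (\<lambda>i j. if i = j + 1 then 3 * real i else 0)"

definition matQ1 :: "real \<Rightarrow> nat \<Rightarrow> complex mat" where
  "matQ1 \<alpha> l = real_mat l (\<lambda>i j. if j = i then \<alpha> - real l + 3 * real i else 0)"

definition matP0 :: "real \<Rightarrow> real \<Rightarrow> real \<Rightarrow> nat \<Rightarrow> complex mat" where
  "matP0 \<alpha> \<beta> k l = real_mat l (\<lambda>i j.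
     if j = i then (\<alpha> + 2 * real l) * (\<beta> + 1 + 2 * real i) - 3 * k * (real l - real i)
                   - 3 * real i * (\<beta> - k + real i)
     else if i = j + 1 then
       - (real i * (3 * real i + 3 * \<beta> - 3 * k + 3 + real l + 2 * \<alpha>))
     else 0)"

definition matP1 :: "real \<Rightarrow> real \<Rightarrow> real \<Rightarrow> nat \<Rightarrow> complex mat" where
  "matP1 \<alpha> \<beta> k l = real_mat l (\<lambda>i j.
     if j = i then - ((\<alpha> - real l + 3 * real i) * (\<alpha> + \<beta> + real l + real i + 2))
     else if j = i + 1 then 3 * (\<beta> - k + 1 + real i) * (real l - real i)
     else 0)"

text \<open>Vector and matrix valued polynomials in \<open>u\<close> are vectors and matrices with polynomial
  entries; \<open>const_mat\<close> embeds the constant matrices and \<open>[:0, 1:]\<close> is the variable \<open>u\<close>.\<close>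

definition const_mat :: "complex mat \<Rightarrow> complex poly mat" where
  "const_mat A = map_mat (\<lambda>c. [:c:]) A"

definition opD :: "real \<Rightarrow> real \<Rightarrow> real \<Rightarrow> nat \<Rightarrow> complex poly vec \<Rightarrow> complex poly vec" where
  "opD \<alpha> \<beta> k l F =
     ([:0, 1:] * [:1, -1:]) \<cdot>\<^sub>v map_vec (\<lambda>p. pderiv (pderiv p)) F
     + (const_mat (matC \<beta> l) - [:0, 1:] \<cdot>\<^sub>m const_mat (matU \<alpha> \<beta> l)) *\<^sub>v map_vec pderiv F
     - const_mat (matV \<alpha> \<beta> k l) *\<^sub>v F"

definition opE :: "real \<Rightarrow> real \<Rightarrow> real \<Rightarrow> nat \<Rightarrow> complex poly mat \<Rightarrow> complex poly mat" where
  "opE \<alpha> \<beta> k l F =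
     ([:1, -1:] \<cdot>\<^sub>m (const_mat (matQ0 l) + [:0, 1:] \<cdot>\<^sub>m const_mat (matQ1 \<alpha> l)))
       * map_mat (\<lambda>p. pderiv (pderiv p)) F
     + (const_mat (matP0 \<alpha> \<beta> k l) + [:0, 1:] \<cdot>\<^sub>m const_mat (matP1 \<alpha> \<beta> k l)) * map_mat pderiv F
     - const_mat (complex_of_real (\<alpha> + 2 * real l + 3 * k) \<cdot>\<^sub>m matV \<alpha> \<beta> k l) * F"

text \<open>Only the values of the weight on the open interval \<open>(0, 1)\<close> are used.\<close>

definition weightZ :: "real \<Rightarrow> real \<Rightarrow> nat \<Rightarrow> real \<Rightarrow> complex mat" where
  "weightZ \<beta> k l u = real_mat l (\<lambda>i j.
     \<Sum>r = 0..l. real (r choose i) * real (r choose j)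
       * ((real l + k - real r - 1) gchoose (l - r)) * ((\<beta> - k + real r) gchoose r)
       * (1 - u) ^ (l - r) * u ^ (i + j))"

definition weightW :: "real \<Rightarrow> real \<Rightarrow> real \<Rightarrow> nat \<Rightarrow> real \<Rightarrow> complex mat" where
  "weightW \<alpha> \<beta> k l u =
     complex_of_real ((1 - u) powr \<alpha> * u powr \<beta>) \<cdot>\<^sub>m weightZ \<beta> k l u"

definition eval_vec :: "complex poly vec \<Rightarrow> real \<Rightarrow> complex vec" where
  "eval_vec F u = map_vec (\<lambda>p. poly p (complex_of_real u)) F"

text \<open>Since \<open>x \<bullet>c y\<close> conjugates its second argument, the integrand is \<open>G(u)\<^sup>* W(u) F(u)\<close>.\<close>

definition orthogonal_W ::
  "real \<Rightarrow> real \<Rightarrow> real \<Rightarrow> nat \<Rightarrow> complex poly vec \<Rightarrow> complex poly vec \<Rightarrow> bool" where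
  "orthogonal_W \<alpha> \<beta> k l F G \<longleftrightarrow>
     integral {0<..<1} (\<lambda>u. (weightW \<alpha> \<beta> k l u *\<^sub>v eval_vec F u) \<bullet>c eval_vec G u) = 0"

definition lam :: "real \<Rightarrow> real \<Rightarrow> real \<Rightarrow> nat \<Rightarrow> nat \<Rightarrow> nat \<Rightarrow> real" where
  "lam \<alpha> \<beta> k l j w =
     - (real w * (real w + \<alpha> + \<beta> + real l + real j + 1))
     - real j * (real j + \<alpha> + \<beta> - k + 1)"

definition mu :: "real \<Rightarrow> real \<Rightarrow> real \<Rightarrow> nat \<Rightarrow> nat \<Rightarrow> nat \<Rightarrow> real" where
  "mu \<alpha> \<beta> k l j w =
     - (real w * (real w + \<alpha> + \<beta> + real l + real j + 1) * (\<alpha> - real l + 3 * real j))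
     - real j * (real j + \<alpha> + \<beta> - k + 1) * (\<alpha> + 2 * real l + 3 * k)"

definition LambdaE :: "real \<Rightarrow> real \<Rightarrow> real \<Rightarrow> nat \<Rightarrow> nat \<Rightarrow> complex mat" where
  "LambdaE \<alpha> \<beta> k l w = mat_diag (l + 1) (\<lambda>j. complex_of_real (mu \<alpha> \<beta> k l j w))"

text \<open>\<open>hyp_coeff C U A i\<close> is \<open>[C; U; A]\<^sub>i\<close>; the third argument will be \<open>V + \<lambda>I\<close>.\<close>

primrec hyp_coeff :: "complex mat \<Rightarrow> complex mat \<Rightarrow> complex mat \<Rightarrow> nat \<Rightarrow> complex mat" where
  "hyp_coeff C U A 0 = 1\<^sub>m (dim_row C)"
| "hyp_coeff C U A (Suc i) =
     the (mat_inverse (C + of_nat i \<cdot>\<^sub>m 1\<^sub>m (dim_row C)))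
     * (of_nat i \<cdot>\<^sub>m (U + (of_nat i - 1) \<cdot>\<^sub>m 1\<^sub>m (dim_row C)) + A)
     * hyp_coeff C U A i"

definition CUV :: "real \<Rightarrow> real \<Rightarrow> real \<Rightarrow> nat \<Rightarrow> complex \<Rightarrow> nat \<Rightarrow> complex mat" where
  "CUV \<alpha> \<beta> k l z i =
     hyp_coeff (matC \<beta> l) (matU \<alpha> \<beta> l) (matV \<alpha> \<beta> k l + z \<cdot>\<^sub>m 1\<^sub>m (l + 1)) i"

definition eigenspace :: "real \<Rightarrow> real \<Rightarrow> real \<Rightarrow> nat \<Rightarrow> complex \<Rightarrow> complex poly vec set" where
  "eigenspace \<alpha> \<beta> k l z = {P \<in> carrier_vec (l + 1). opD \<alpha> \<beta> k l P = [:z:] \<cdot>\<^sub>v P}"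

definition not_repeated :: "real \<Rightarrow> real \<Rightarrow> real \<Rightarrow> nat \<Rightarrow> nat \<Rightarrow> nat \<Rightarrow> bool" where
  "not_repeated \<alpha> \<beta> k l w j \<longleftrightarrow>
     (\<forall>w' j'. j' \<le> l \<and> (w', j') \<noteq> (w, j) \<longrightarrow> lam \<alpha> \<beta> k l j' w' \<noteq> lam \<alpha> \<beta> k l j w)"

definition rhs_vec :: "real \<Rightarrow> real \<Rightarrow> real \<Rightarrow> nat \<Rightarrow> nat \<Rightarrow> nat \<Rightarrow> complex vec" where
  "rhs_vec \<alpha> \<beta> k l w j = vec (l + 1) (\<lambda>i.
     if i \<le> j then complex_of_real
       ((-1) ^ (i + j) * real ((l - i) choose (l - j))
        * pochhammer (\<beta> - k + 1 + real i) (j - i)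
        / pochhammer (\<alpha> + \<beta> + real j + real i + real w - k + 1) (j - i))
     else 0)"

definition F0_vec :: "real \<Rightarrow> real \<Rightarrow> real \<Rightarrow> nat \<Rightarrow> nat \<Rightarrow> nat \<Rightarrow> complex vec" where
  "F0_vec \<alpha> \<beta> k l w j = (THE F0. F0 \<in> carrier_vec (l + 1) \<and>
     CUV \<alpha> \<beta> k l (complex_of_real (lam \<alpha> \<beta> k l j w)) w *\<^sub>v F0 = rhs_vec \<alpha> \<beta> k l w j)"

text \<open>\<open>P(u) = (\<Sum>i\<ge>0. u^i / i! [C; U; V + \<lambda>\<^sub>j(w)]\<^sub>i F\<^sub>0)\<close>, stated coefficient by coefficient.\<close>

definition hyp_poly ::
  "real \<Rightarrow> real \<Rightarrow> real \<Rightarrow> nat \<Rightarrow> nat \<Rightarrow> nat \<Rightarrow> complex poly vec \<Rightarrow> bool" where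
  "hyp_poly \<alpha> \<beta> k l w j P \<longleftrightarrow> P \<in> carrier_vec (l + 1) \<and>
     (\<forall>i. map_vec (\<lambda>p. coeff p i) P =
        (1 / fact i) \<cdot>\<^sub>v
          (CUV \<alpha> \<beta> k l (complex_of_real (lam \<alpha> \<beta> k l j w)) i *\<^sub>v F0_vec \<alpha> \<beta> k l w j))"

text \<open>\<open>ps\<close> is the list \<open>(w\<^sub>1, j\<^sub>1), \<dots>, (w\<^sub>s, j\<^sub>s)\<close> of all pairs with \<open>\<lambda>\<^sub>j(w) = z\<close>,
  with \<open>w\<^sub>1 < \<dots> < w\<^sub>s\<close>. List positions start at \<open>0\<close>, so \<open>(w\<^sub>r, j\<^sub>r) = ps ! (r - 1)\<close>.\<close>

definition pair_listing ::
  "real \<Rightarrow> real \<Rightarrow> real \<Rightarrow> nat \<Rightarrow> real \<Rightarrow> (nat \<times> nat) list \<Rightarrow> bool" where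
  "pair_listing \<alpha> \<beta> k l z ps \<longleftrightarrow>
     set ps = {(w, j). j \<le> l \<and> lam \<alpha> \<beta> k l j w = z} \<and>
     sorted_wrt (\<lambda>p q. fst p < fst q) ps"

definition V_sub ::
  "real \<Rightarrow> real \<Rightarrow> real \<Rightarrow> nat \<Rightarrow> real \<Rightarrow> (nat \<times> nat) list \<Rightarrow> nat \<Rightarrow> complex poly vec set" where
  "V_sub \<alpha> \<beta> k l z ps r =
     (if r = 0 then {0\<^sub>v (l + 1)}
      else {P \<in> eigenspace \<alpha> \<beta> k l (complex_of_real z).
              \<forall>i < l + 1. degree (P $ i) \<le> fst (ps ! (r - 1))})"

text \<open>The vectors of case (2) are not determined uniquely, so the construction is a predicate on
  the whole family: \<open>p w j\<close> stands for \<open>P\<^sub>w\<^sup>j\<close>.\<close>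

definition constructed_family ::
  "real \<Rightarrow> real \<Rightarrow> real \<Rightarrow> nat \<Rightarrow> (nat \<Rightarrow> nat \<Rightarrow> complex poly vec) \<Rightarrow> bool" where
  "constructed_family \<alpha> \<beta> k l p \<longleftrightarrow>
     (\<forall>w j. j \<le> l \<and> not_repeated \<alpha> \<beta> k l w j \<longrightarrow> hyp_poly \<alpha> \<beta> k l w j (p w j)) \<and>
     (\<forall>z ps. pair_listing \<alpha> \<beta> k l z ps \<and> length ps \<ge> 2 \<longrightarrow>
        (\<forall>r \<in> {1..length ps}.
           let (w, j) = ps ! (r - 1) in
             p w j \<in> V_sub \<alpha> \<beta> k l z ps r \<and>
             p w j \<noteq> 0\<^sub>v (l + 1) \<and>
             (\<forall>Q \<in> V_sub \<alpha> \<beta> k l z ps (r - 1). orthogonal_W \<alpha> \<beta> k l (p w j) Q)))"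

text \<open>\<open>pstar P\<close> is the matrix polynomial with \<open>(pstar P)(u) = P(u)\<^sup>*\<close> for real \<open>u\<close>.\<close>

definition pstar :: "complex poly mat \<Rightarrow> complex poly mat" where
  "pstar P = transpose_mat (map_mat (map_poly cnj) P)"

end

theory Submission
  imports Defs "Jordan_Normal_Form.Determinant" "HOL-Analysis.Gamma_Function"
begin

text \<open>
  The theorem rests on three properties of \<open>E\<close>: it commutes with \<open>D\<close>, it does not raise
  degrees, and it is symmetric for the weight \<open>W\<close>.

  By the first two, \<open>E\<close> maps the space of eigenfunctions of \<open>D\<close> for \<open>\<lambda>\<close> of degree at most
  \<open>n\<close> into itself. On the coefficient vectors of \<open>u^n\<close> both operators act, up to
  contributions of higher coefficients, by upper triangular matrices with diagonals
  \<open>\<lambda>\<^sub>i(n)\<close> and \<open>\<mu>\<^sub>i(n)\<close>. Hence a nonzero eigenfunction \<open>P\<close> of \<open>D\<close> has a leading position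
  \<open>(w, j)\<close>, its degree and the last component of that degree, at which
  \<open>\<lambda> = \<lambda>\<^sub>j(w)\<close>. The defect \<open>Q = E P - \<mu>\<^sub>j(w) P\<close> is again an eigenfunction for \<open>\<lambda>\<close>, and
  its degree is smaller than \<open>w\<close>: its coefficient at \<open>(w, j)\<close> vanishes, and no other
  component \<open>i\<close> could lead in degree \<open>w\<close>, since the \<open>\<lambda>\<^sub>i(w)\<close> are pairwise distinct
  (\<open>eigen_defect_leading\<close>).

  If \<open>\<lambda>\<close> is not repeated, there is no leading position left for \<open>Q\<close>, so \<open>Q = 0\<close>. If it is
  repeated and \<open>P = P\<^sub>r\<close> is the given vector of \<open>V\<^sub>r\<close>, then \<open>Q\<close> lies in \<open>V\<^sub>r\<^sub>-\<^sub>1\<close>, and so does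
  \<open>E Q\<close>. As \<open>P\<^sub>r\<close> is orthogonal to \<open>V\<^sub>r\<^sub>-\<^sub>1\<close>, symmetry gives
  \<open>\<langle>Q, Q\<rangle> = \<langle>P\<^sub>r, E Q\<rangle> - \<mu> \<langle>P\<^sub>r, Q\<rangle> = 0\<close>, and \<open>Q = 0\<close> because \<open>W\<close> is positive definite.

  Symmetry and definiteness become visible after the substitution
  \<open>f\<^sub>r = \<Sum>\<^sub>i binom(r, i) u^i F\<^sub>i\<close>, which diagonalises the weight:
  \<open>G\<^sup>* W F = \<Sum>\<^sub>r c\<^sub>r (1 - u)^(\<alpha> + l - r) u^\<beta> conj(g\<^sub>r) f\<^sub>r\<close> with \<open>c\<^sub>r > 0\<close>. In the
  coordinates \<open>f\<^sub>r\<close> the operator \<open>E\<close> is tridiagonal (\<open>pascal_rowE\<close>). Its diagonal consists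
  of Jacobi operators, self-adjoint for \<open>(1 - u)^(\<alpha> + l - r) u^\<beta>\<close>; its off-diagonal
  entries are of first order, and the entries at \<open>(r, r + 1)\<close> and \<open>(r + 1, r)\<close> are adjoint to each
  other (\<open>form_density_rowE_symmetric\<close>).
\<close>

section \<open>The operators on components and on coefficients\<close>

text \<open>Real constants are kept as the opaque ring elements \<open>cst x\<close>, so that the identities below are
  identities in the ring of polynomials, where Groebner bases decide them.\<close>

definition cst :: "real \<Rightarrow> complex poly" where
  "cst x = [:complex_of_real x:]"

lemma cst_hom:
  "cst (x + y) = cst x + cst y" "cst (x - y) = cst x - cst y" "cst (x * y) = cst x * cst y"
  "cst (- x) = - cst x" "cst 0 = 0" "cst 1 = 1" "cst (numeral m) = numeral m"
  "cst (real n) = of_nat n"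
  by (simp_all add: cst_def one_pCons numeral_poly of_nat_poly)

lemma coeff_cst_mult: "coeff (cst x * p) n = complex_of_real x * coeff p n"
  by (simp add: cst_def)

lemma pderiv_cst_mult: "pderiv (cst x * p) = cst x * pderiv p"
  by (simp add: cst_def pderiv_smult)

lemma coeff_u_mult: "coeff ([:0, 1:] * p) n = (if n = 0 then 0 else coeff p (n - 1))"
  for p :: "'a::comm_ring_1 poly"
  by (cases n) (simp_all add: coeff_pCons)

text \<open>The coefficient of \<open>u^n\<close> in row \<open>i\<close> of \<open>D F\<close>, in terms of those coefficients of \<open>F\<close> that
  occur in it: \<open>x\<close> at \<open>(i, n)\<close>, \<open>xp\<close> at \<open>(i + 1, n)\<close>, \<open>x1\<close> at \<open>(i, n + 1)\<close> and \<open>xm\<close> at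
  \<open>(i - 1, n + 1)\<close>. For \<open>E\<close> there is also \<open>xm2\<close> at \<open>(i - 1, n + 2)\<close>, which comes from the
  term \<open>Q\<^sub>0 d^2/du^2\<close>. The factor of \<open>x\<close> is \<open>\<lambda>\<^sub>i(n)\<close> for \<open>D\<close> and \<open>\<mu>\<^sub>i(n)\<close> for \<open>E\<close>.\<close>

definition D_coeff :: "'a::idom \<Rightarrow> 'a \<Rightarrow> 'a \<Rightarrow> 'a \<Rightarrow> 'a \<Rightarrow> 'a \<Rightarrow> 'a \<Rightarrow> 'a \<Rightarrow> 'a \<Rightarrow> 'a \<Rightarrow> 'a" where
  "D_coeff a b k l i n x xp x1 xm =
     (- (n * (n + a + b + l + i + 1)) - i * (i + a + b - k + 1)) * x
     + (l - i) * (b - k + 1 + i) * xp + (n + 1) * (n + b + 1 + 2 * i) * x1 + i * (n + 1) * xm"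

definition E_coeff :: "'a::idom \<Rightarrow> 'a \<Rightarrow> 'a \<Rightarrow> 'a \<Rightarrow> 'a \<Rightarrow> 'a \<Rightarrow> 'a \<Rightarrow> 'a \<Rightarrow> 'a \<Rightarrow> 'a \<Rightarrow> 'a \<Rightarrow> 'a" where
  "E_coeff a b k l i n x xp x1 xm xm2 =
     (- (n * (n + a + b + l + i + 1) * (a - l + 3 * i)) - i * (i + a + b - k + 1) * (a + 2 * l + 3 * k)) * x
     + (l - i) * (b - k + 1 + i) * (3 * n + a + 2 * l + 3 * k) * xp
     + (n + 1) * ((a - l + 3 * i) * n + (a + 2 * l) * (b + 1 + 2 * i) - 3 * k * (l - i) - 3 * i * (b - k + i)) * x1
     - i * (n + 1) * (3 * n + 3 * i + 3 * b - 3 * k + 3 + l + 2 * a) * xm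
     + 3 * i * (n + 1) * (n + 2) * xm2"

text \<open>The letters of a variable encode the shift of the row (\<open>o\<close>, \<open>p\<close>, \<open>pp\<close>, \<open>m\<close>, \<open>mm\<close> for
  \<open>0, 1, 2, -1, -2\<close>) and the digit the shift of the power of \<open>u\<close>. With the row \<open>i\<close> and the
  power \<open>n\<close> as ring elements, commutation of \<open>D\<close> and \<open>E\<close> is a single polynomial identity.\<close>

lemma D_coeff_E_coeff_commute:
  fixes a b k l i n xo0 :: "'a::idom"
  shows
    "D_coeff a b k l i n
       (E_coeff a b k l i n xo0 xp0 xo1 xm1 xm2)
       (E_coeff a b k l (i + 1) n xp0 xpp0 xp1 xo1 xo2)
       (E_coeff a b k l i (n + 1) xo1 xp1 xo2 xm2 xm3)
       (E_coeff a b k l (i - 1) (n + 1) xm1 xo1 xm2 xmm2 xmm3)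
     = E_coeff a b k l i n
       (D_coeff a b k l i n xo0 xp0 xo1 xm1)
       (D_coeff a b k l (i + 1) n xp0 xpp0 xp1 xo1)
       (D_coeff a b k l i (n + 1) xo1 xp1 xo2 xm2)
       (D_coeff a b k l (i - 1) (n + 1) xm1 xo1 xm2 xmm2)
       (D_coeff a b k l (i - 1) (n + 2) xm2 xo2 xm3 xmm3)"
  unfolding D_coeff_def E_coeff_def by Groebner_Basis.algebra

locale jacobi_params =
  fixes \<alpha> \<beta> k :: real and l :: nat
begin

text \<open>Rows of \<open>D\<close> and \<open>E\<close> acting on a sequence of polynomials. The natural subtraction in
  \<open>F (i - 1)\<close> is harmless: its factor vanishes for \<open>i = 0\<close>. Likewise \<open>F (l + 1)\<close>, which lies
  outside the vector, has the factor \<open>l - i = 0\<close> in row \<open>l\<close>; so the operators can be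
  composed without boundary cases.\<close>

definition rowD :: "(nat \<Rightarrow> complex poly) \<Rightarrow> nat \<Rightarrow> complex poly" where
  "rowD F i =
     [:0, 1:] * (1 - [:0, 1:]) * pderiv (pderiv (F i))
     + cst (\<beta> + 1 + 2 * real i) * pderiv (F i) + cst (real i) * pderiv (F (i - 1))
     - [:0, 1:] * (cst (\<alpha> + \<beta> + real l + real i + 2) * pderiv (F i))
     - cst (real i * (\<alpha> + \<beta> - k + 1 + real i)) * F i
     + cst ((real l - real i) * (\<beta> - k + 1 + real i)) * F (i + 1)"

definition rowE :: "(nat \<Rightarrow> complex poly) \<Rightarrow> nat \<Rightarrow> complex poly" where
  "rowE F i =
     (1 - [:0, 1:]) * (cst (3 * real i) * pderiv (pderiv (F (i - 1)))
        + [:0, 1:] * (cst (\<alpha> - real l + 3 * real i) * pderiv (pderiv (F i))))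
     + cst ((\<alpha> + 2 * real l) * (\<beta> + 1 + 2 * real i) - 3 * k * (real l - real i)
            - 3 * real i * (\<beta> - k + real i)) * pderiv (F i)
     - cst (real i * (3 * real i + 3 * \<beta> - 3 * k + 3 + real l + 2 * \<alpha>)) * pderiv (F (i - 1))
     - [:0, 1:] * (cst ((\<alpha> - real l + 3 * real i) * (\<alpha> + \<beta> + real l + real i + 2)) * pderiv (F i))
     + [:0, 1:] * (cst (3 * (\<beta> - k + 1 + real i) * (real l - real i)) * pderiv (F (i + 1)))
     - cst ((\<alpha> + 2 * real l + 3 * k) * (real i * (\<alpha> + \<beta> - k + 1 + real i))) * F i
     + cst ((\<alpha> + 2 * real l + 3 * k) * ((real l - real i) * (\<beta> - k + 1 + real i))) * F (i + 1)"

abbreviation (input) D_coeff_params where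
  "D_coeff_params \<equiv> D_coeff (complex_of_real \<alpha>) (complex_of_real \<beta>) (complex_of_real k) (of_nat l)"

abbreviation (input) E_coeff_params where
  "E_coeff_params \<equiv> E_coeff (complex_of_real \<alpha>) (complex_of_real \<beta>) (complex_of_real k) (of_nat l)"

lemma coeff_rowD:
  "coeff (rowD F i) n =
     D_coeff_params (of_nat i) (of_nat n) (coeff (F i) n) (coeff (F (i + 1)) n)
       (coeff (F i) (n + 1)) (coeff (F (i - 1)) (n + 1))"
  unfolding rowD_def D_coeff_def left_diff_distrib right_diff_distrib distrib_left distrib_right
    mult.assoc mult_1_left coeff_add coeff_diff coeff_u_mult coeff_cst_mult coeff_pderiv
  by (cases n; cases "n - 1"; simp add: algebra_simps)

lemma coeff_rowE:
  "coeff (rowE F i) n =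
     E_coeff_params (of_nat i) (of_nat n) (coeff (F i) n) (coeff (F (i + 1)) n)
       (coeff (F i) (n + 1)) (coeff (F (i - 1)) (n + 1)) (coeff (F (i - 1)) (n + 2))"
  unfolding rowE_def E_coeff_def left_diff_distrib right_diff_distrib distrib_left distrib_right
    mult.assoc mult_1_left coeff_add coeff_diff coeff_u_mult coeff_cst_mult coeff_pderiv
  by (cases n; cases "n - 1"; simp add: algebra_simps)

text \<open>This is \<open>D_coeff_E_coeff_commute\<close> applied to the coefficients of \<open>F\<close>. Only row \<open>0\<close> needs care: there
  \<open>rowE F (i - 1)\<close> is row \<open>0\<close> instead of the formal row \<open>-1\<close>.\<close>

lemma rowD_rowE_commute: "rowD (rowE F) i = rowE (rowD F) i"
proof (rule poly_eqI)
  fix n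
  let ?x = "\<lambda>i n. coeff (F i) n"
  let ?d = "\<lambda>i n. coeff (rowD F i) n" and ?e = "\<lambda>i n. coeff (rowE F i) n"
  \<comment> \<open>In row \<open>0\<close> the values of \<open>e1\<close>, \<open>d1\<close>, \<open>d2\<close> get the factor \<open>0\<close>, so they may be replaced by
    what the formal row \<open>-1\<close> would give.\<close>
  define e1 where "e1 = (if i = 0
    then E_coeff_params (of_nat i - 1) (of_nat n + 1) (?x (i-1) (n+1)) (?x i (n+1)) (?x (i-1) (n+2)) (?x (i-2) (n+2)) (?x (i-2) (n+3))
    else ?e (i-1) (n+1))"
  define d1 where "d1 = (if i = 0
    then D_coeff_params (of_nat i - 1) (of_nat n + 1) (?x (i-1) (n+1)) (?x i (n+1)) (?x (i-1) (n+2)) (?x (i-2) (n+2))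
    else ?d (i-1) (n+1))"
  define d2 where "d2 = (if i = 0
    then D_coeff_params (of_nat i - 1) (of_nat n + 2) (?x (i-1) (n+2)) (?x i (n+2)) (?x (i-1) (n+3)) (?x (i-2) (n+3))
    else ?d (i-1) (n+2))"
  have e1: "e1 = E_coeff_params (of_nat i - 1) (of_nat n + 1) (?x (i-1) (n+1)) (?x i (n+1)) (?x (i-1) (n+2)) (?x (i-2) (n+2)) (?x (i-2) (n+3))"
    by (cases i) (simp_all add: e1_def coeff_rowE add.commute numeral_eq_Suc)
  have d1: "d1 = D_coeff_params (of_nat i - 1) (of_nat n + 1) (?x (i-1) (n+1)) (?x i (n+1)) (?x (i-1) (n+2)) (?x (i-2) (n+2))"
    by (cases i) (simp_all add: d1_def coeff_rowD add.commute numeral_eq_Suc)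
  have d2: "d2 = D_coeff_params (of_nat i - 1) (of_nat n + 2) (?x (i-1) (n+2)) (?x i (n+2)) (?x (i-1) (n+3)) (?x (i-2) (n+3))"
    by (cases i) (simp_all add: d2_def coeff_rowD add.commute numeral_eq_Suc)
  have "coeff (rowD (rowE F) i) n = D_coeff_params (of_nat i) (of_nat n) (?e i n) (?e (i+1) n) (?e i (n+1)) e1"
    by (simp add: coeff_rowD e1_def D_coeff_def)
  also have "\<dots> = E_coeff_params (of_nat i) (of_nat n) (?d i n) (?d (i+1) n) (?d i (n+1)) d1 d2"
  proof -
    have [simp]: "Suc i - 2 = i - 1" by simp
    show ?thesis
      unfolding e1 d1 d2 coeff_rowD coeff_rowE
      using D_coeff_E_coeff_commute[of "complex_of_real \<alpha>" "complex_of_real \<beta>" "complex_of_real k" "of_nat l"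
          "of_nat i" "of_nat n" "?x i n" "?x (i+1) n" "?x i (n+1)" "?x (i-1) (n+1)" "?x (i-1) (n+2)"
          "?x (i+2) n" "?x (i+1) (n+1)" "?x i (n+2)" "?x (i-1) (n+3)" "?x (i-2) (n+2)" "?x (i-2) (n+3)"]
      by (simp add: add.commute add.left_commute numeral_eq_Suc)
  qed
  also have "\<dots> = coeff (rowE (rowD F) i) n"
    by (simp add: coeff_rowE d1_def d2_def E_coeff_def)
  finally show "coeff (rowD (rowE F) i) n = coeff (rowE (rowD F) i) n" .
qed

end

section \<open>Leading positions of eigenfunctions\<close>

lemma sum_tridiagonal:
  fixes i l :: nat
  assumes "i \<le> l"
  shows "(\<Sum>j<l + 1. (if j = i then x j else if i = j + 1 then y j else if j = i + 1 then z j else 0))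
    = x i + (if i = 0 then 0 else y (i - 1)) + (if i = l then 0 else (z (i + 1) :: 'a::comm_monoid_add))"
proof -
  have "(\<Sum>j<l + 1. (if j = i then x j else if i = j + 1 then y j else if j = i + 1 then z j else 0))
     = (\<Sum>j<l + 1. (if j = i then x j else 0) + (if j = i - 1 then (if i = 0 then 0 else y j) else 0)
         + (if j = i + 1 then z j else 0))"
    by (intro sum.cong) auto
  also have "\<dots> = x i + (if i = 0 then 0 else y (i - 1)) + (if i = l then 0 else z (i + 1))"
    using assms by (auto simp: sum.distrib simp del: sum.lessThan_Suc)
  finally show ?thesis .
qed

context jacobi_params begin

lemma rowD_cong:
  assumes "i \<le> l" "\<And>j. j \<le> l \<Longrightarrow> F j = G j"
  shows "rowD F i = rowD G i"
  using assms by (cases "i = l") (auto simp: rowD_def cst_hom)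

lemma rowE_cong:
  assumes "i \<le> l" "\<And>j. j \<le> l \<Longrightarrow> F j = G j"
  shows "rowE F i = rowE G i"
  using assms by (cases "i = l") (auto simp: rowE_def cst_hom)

lemma opD_index:
  assumes F: "F \<in> carrier_vec (l + 1)" and i: "i \<le> l"
  shows "opD \<alpha> \<beta> k l F $ i = rowD (vec_index F) i"
proof -
  have "opD \<alpha> \<beta> k l F $ i =
     [:0, 1:] * [:1, -1:] * pderiv (pderiv (F $ i))
     + (\<Sum>j<l + 1. (cst (if j = i then \<beta> + 1 + 2 * real i else if i = j + 1 then real i else 0)
          - [:0, 1:] * cst (if j = i then \<alpha> + \<beta> + real l + real i + 2 else 0)) * pderiv (F $ j))
     - (\<Sum>j<l + 1. cst (if j = i then real i * (\<alpha> + \<beta> - k + 1 + real i)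
          else if j = i + 1 then - ((real l - real i) * (\<beta> - k + 1 + real i)) else 0) * F $ j)"
    using assms
    by (simp add: opD_def const_mat_def matC_def matU_def matV_def real_mat_def scalar_prod_def
        atLeast0LessThan cst_def del: mult_pCons_left mult_pCons_right sum.lessThan_Suc)
  also have "(\<Sum>j<l + 1. (cst (if j = i then \<beta> + 1 + 2 * real i else if i = j + 1 then real i else 0)
          - [:0, 1:] * cst (if j = i then \<alpha> + \<beta> + real l + real i + 2 else 0)) * pderiv (F $ j))
     = (\<Sum>j<l + 1. if j = i then (cst (\<beta> + 1 + 2 * real i) - [:0, 1:] * cst (\<alpha> + \<beta> + real l + real i + 2))
            * pderiv (F $ j)
          else if i = j + 1 then cst (real i) * pderiv (F $ j) else if j = i + 1 then 0 else 0)"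
    by (intro sum.cong) (auto simp: cst_hom)
  also have "(\<Sum>j<l + 1. cst (if j = i then real i * (\<alpha> + \<beta> - k + 1 + real i)
          else if j = i + 1 then - ((real l - real i) * (\<beta> - k + 1 + real i)) else 0) * F $ j)
     = (\<Sum>j<l + 1. if j = i then cst (real i * (\<alpha> + \<beta> - k + 1 + real i)) * F $ j
          else if i = j + 1 then 0
          else if j = i + 1 then cst (- ((real l - real i) * (\<beta> - k + 1 + real i))) * F $ j else 0)"
    by (intro sum.cong) (auto simp: cst_hom)
  also note eq = calculation
  have u: "[:1, -1:] = (1 - [:0, 1:] :: complex poly)" by (simp add: one_pCons)
  show ?thesis
    unfolding eq sum_tridiagonal[OF i] rowD_def u
    apply (cases "i = 0"; cases "i = l")
    apply (simp_all only: if_True if_False refl cst_hom of_nat_0 simp_thms)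
    \<comment> \<open>What remains are ring identities; the case distinctions on indices are not part of them.\<close>
    apply ((erule thin_rl)+, Groebner_Basis.algebra)+
    done
qed

lemma opE_index:
  assumes M: "M \<in> carrier_mat (l + 1) (l + 1)" and i: "i \<le> l" and c: "c \<le> l"
  shows "opE \<alpha> \<beta> k l M $$ (i, c) = rowE (\<lambda>j. M $$ (j, c)) i"
proof -
  have "opE \<alpha> \<beta> k l M $$ (i, c) =
     (\<Sum>j<l + 1. [:1, -1:] * (cst (if i = j + 1 then 3 * real i else 0)
          + [:0, 1:] * cst (if j = i then \<alpha> - real l + 3 * real i else 0)) * pderiv (pderiv (M $$ (j, c))))
     + (\<Sum>j<l + 1. (cst (if j = i then (\<alpha> + 2 * real l) * (\<beta> + 1 + 2 * real i) - 3 * k * (real l - real i)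
                   - 3 * real i * (\<beta> - k + real i)
               else if i = j + 1 then
               - (real i * (3 * real i + 3 * \<beta> - 3 * k + 3 + real l + 2 * \<alpha>))
               else 0)
          + [:0, 1:] * cst (if j = i then - ((\<alpha> - real l + 3 * real i) * (\<alpha> + \<beta> + real l + real i + 2))
               else if j = i + 1 then 3 * (\<beta> - k + 1 + real i) * (real l - real i)
               else 0)) * pderiv (M $$ (j, c)))
     - (\<Sum>j<l + 1. cst ((\<alpha> + 2 * real l + 3 * k) * (if j = i then real i * (\<alpha> + \<beta> - k + 1 + real i)
          else if j = i + 1 then - ((real l - real i) * (\<beta> - k + 1 + real i)) else 0)) * M $$ (j, c))"
    using assms
    by (simp add: opE_def const_mat_def matQ0_def matQ1_def matP0_def matP1_def matV_def real_mat_def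
        times_mat_def scalar_prod_def
        atLeast0LessThan cst_def del: mult_pCons_left mult_pCons_right sum.lessThan_Suc)
  also have "(\<Sum>j<l + 1. [:1, -1:] * (cst (if i = j + 1 then 3 * real i else 0)
          + [:0, 1:] * cst (if j = i then \<alpha> - real l + 3 * real i else 0)) * pderiv (pderiv (M $$ (j, c))))
    = (\<Sum>j<l + 1. if j = i then [:1, -1:] * ([:0, 1:] * cst (\<alpha> - real l + 3 * real i)) * pderiv (pderiv (M $$ (j, c)))
        else if i = j + 1 then [:1, -1:] * cst (3 * real i) * pderiv (pderiv (M $$ (j, c)))
        else if j = i + 1 then 0 else 0)"
    by (intro sum.cong) (auto simp: cst_hom)
  also have "(\<Sum>j<l + 1. (cst (if j = i then (\<alpha> + 2 * real l) * (\<beta> + 1 + 2 * real i) - 3 * k * (real l - real i)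
                   - 3 * real i * (\<beta> - k + real i)
               else if i = j + 1 then
               - (real i * (3 * real i + 3 * \<beta> - 3 * k + 3 + real l + 2 * \<alpha>))
               else 0)
          + [:0, 1:] * cst (if j = i then - ((\<alpha> - real l + 3 * real i) * (\<alpha> + \<beta> + real l + real i + 2))
               else if j = i + 1 then 3 * (\<beta> - k + 1 + real i) * (real l - real i)
               else 0)) * pderiv (M $$ (j, c)))
    = (\<Sum>j<l + 1. if j = i then (cst ((\<alpha> + 2 * real l) * (\<beta> + 1 + 2 * real i) - 3 * k * (real l - real i)
                   - 3 * real i * (\<beta> - k + real i))
            + [:0, 1:] * cst (- ((\<alpha> - real l + 3 * real i) * (\<alpha> + \<beta> + real l + real i + 2)))) * pderiv (M $$ (j, c))
        else if i = j + 1 then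
            cst (- (real i * (3 * real i + 3 * \<beta> - 3 * k + 3 + real l + 2 * \<alpha>))) * pderiv (M $$ (j, c))
        else if j = i + 1 then [:0, 1:] * cst (3 * (\<beta> - k + 1 + real i) * (real l - real i)) * pderiv (M $$ (j, c))
        else 0)"
    by (intro sum.cong) (auto simp: cst_hom)
  also have "(\<Sum>j<l + 1. cst ((\<alpha> + 2 * real l + 3 * k) * (if j = i then real i * (\<alpha> + \<beta> - k + 1 + real i)
          else if j = i + 1 then - ((real l - real i) * (\<beta> - k + 1 + real i)) else 0)) * M $$ (j, c))
     = (\<Sum>j<l + 1. if j = i then cst ((\<alpha> + 2 * real l + 3 * k) * (real i * (\<alpha> + \<beta> - k + 1 + real i))) * M $$ (j, c)
          else if i = j + 1 then 0
          else if j = i + 1 then cst ((\<alpha> + 2 * real l + 3 * k) * - ((real l - real i) * (\<beta> - k + 1 + real i)))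
             * M $$ (j, c) else 0)"
    by (intro sum.cong) (auto simp: cst_hom)
  also note eq = calculation
  have u: "[:1, -1:] = (1 - [:0, 1:] :: complex poly)" by (simp add: one_pCons)
  show ?thesis
    unfolding eq sum_tridiagonal[OF i] rowE_def u
    apply (cases "i = 0"; cases "i = l")
    apply (simp_all only: if_True if_False refl cst_hom of_nat_0 simp_thms)
    \<comment> \<open>What remains are ring identities; the case distinctions on indices are not part of them.\<close>
    apply ((erule thin_rl)+, Groebner_Basis.algebra)+
    done
qed

text \<open>All nonzero coefficients are, in the order by degree and then by component, at most at \<open>(w, j)\<close>.
  The coefficient at \<open>(w, j)\<close> itself may be zero.\<close>

definition leading_at :: "(nat \<Rightarrow> complex poly) \<Rightarrow> nat \<Rightarrow> nat \<Rightarrow> bool" where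
  "leading_at F w j \<longleftrightarrow> j \<le> l \<and> (\<forall>i\<le>l. \<forall>n. coeff (F i) n \<noteq> 0 \<longrightarrow> n < w \<or> n = w \<and> i \<le> j)"

lemma leading_at_vanish:
  assumes "leading_at F w j" "i \<le> l" "w < n \<or> n = w \<and> j < i"
  shows "coeff (F i) n = 0"
proof (rule ccontr)
  assume "coeff (F i) n \<noteq> 0"
  then have "n < w \<or> n = w \<and> i \<le> j" using assms(1,2) unfolding leading_at_def by blast
  then show False using assms(3) by linarith
qed

text \<open>Every coefficient of \<open>F\<close> in the formula for the coefficient at \<open>(w, j)\<close>, except the one at \<open>(w, j)\<close>,
  lies above \<open>(w, j)\<close> or has factor \<open>0\<close>; the same holds for \<open>E\<close>.\<close>

lemma coeff_rowD_leading:
  assumes "leading_at F w j"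
  shows "coeff (rowD F j) w = of_real (lam \<alpha> \<beta> k l j w) * coeff (F j) w"
proof -
  have j: "j \<le> l" using assms by (simp add: leading_at_def)
  note z = leading_at_vanish[OF assms]
  show ?thesis
    unfolding coeff_rowD D_coeff_def lam_def using j z by (cases "j = l") simp_all
qed

lemma coeff_rowE_leading:
  assumes "leading_at F w j"
  shows "coeff (rowE F j) w = of_real (mu \<alpha> \<beta> k l j w) * coeff (F j) w"
proof -
  have j: "j \<le> l" using assms by (simp add: leading_at_def)
  note z = leading_at_vanish[OF assms]
  show ?thesis
    unfolding coeff_rowE E_coeff_def mu_def using j z by (cases "j = l") simp_all
qed

lemma degree_rowE_le:
  assumes "\<And>j. j \<le> l \<Longrightarrow> degree (F j) \<le> w" "i \<le> l"
  shows "degree (rowE F i) \<le> w"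
proof (rule degree_le, intro allI impI)
  fix n assume n: "w < n"
  have z: "coeff (F j) m = 0" if "j \<le> l" "w < m" for j m
    using assms(1)[OF that(1)] that(2) by (intro coeff_eq_0) simp
  show "coeff (rowE F i) n = 0"
    unfolding coeff_rowE E_coeff_def using z n assms(2) by (cases "i = l") simp_all
qed

lemma leading_exists:
  assumes "\<exists>i\<le>l. F i \<noteq> 0"
  obtains w j where "leading_at F w j" "coeff (F j) w \<noteq> 0"
proof -
  let ?S = "{i. i \<le> l \<and> F i \<noteq> 0}"
  define w where "w = Max ((\<lambda>i. degree (F i)) ` ?S)"
  have fin: "finite ((\<lambda>i. degree (F i)) ` ?S)" and ne: "?S \<noteq> {}" using assms by auto
  have w_max: "degree (F i) \<le> w" if "i \<in> ?S" for i
    unfolding w_def using fin that by (intro Max_ge) auto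
  have "w \<in> (\<lambda>i. degree (F i)) ` ?S" unfolding w_def using fin ne by (intro Max_in) auto
  then obtain i0 where i0: "i0 \<le> l" "F i0 \<noteq> 0" "w = degree (F i0)" by auto
  let ?T = "{i. i \<le> l \<and> coeff (F i) w \<noteq> 0}"
  have T: "finite ?T" "?T \<noteq> {}" using i0 by (auto intro: leading_coeff_neq_0)
  define j where "j = Max ?T"
  have jT: "j \<in> ?T" unfolding j_def using T by (intro Max_in)
  have jmax: "i \<le> j" if "i \<in> ?T" for i unfolding j_def using T that by (intro Max_ge)
  have "leading_at F w j"
    unfolding leading_at_def
  proof (intro conjI allI impI)
    fix i n assume i: "i \<le> l" "coeff (F i) n \<noteq> 0"
    then have "F i \<noteq> 0" by auto
    then have "n \<le> w" using w_max[of i] i le_degree[OF i(2)] by auto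
    then show "n < w \<or> n = w \<and> i \<le> j" using jmax i by (cases "n = w") auto
  qed (use jT in auto)
  then show ?thesis using that jT by auto
qed

definition eigenfun :: "real \<Rightarrow> (nat \<Rightarrow> complex poly) \<Rightarrow> bool" where
  "eigenfun z F \<longleftrightarrow> (\<forall>i\<le>l. rowD F i = cst z * F i)"

lemma eigenfun_leading:
  assumes "eigenfun z F" "leading_at F w j" "coeff (F j) w \<noteq> 0"
  shows "lam \<alpha> \<beta> k l j w = z"
proof -
  have "j \<le> l" using assms(2) by (simp add: leading_at_def)
  then have "of_real (lam \<alpha> \<beta> k l j w) * coeff (F j) w = of_real z * coeff (F j) w"
    using assms(1) coeff_rowD_leading[OF assms(2)] by (auto simp: eigenfun_def coeff_cst_mult)
  then show ?thesis using assms(3) by auto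
qed

lemma rowD_lincomb:
  "rowD (\<lambda>i. cst a * F i + cst b * G i) i = cst a * rowD F i + cst b * rowD G i"
  unfolding rowD_def pderiv_add pderiv_cst_mult by (simp only: algebra_simps)

lemma rowE_lincomb:
  "rowE (\<lambda>i. cst a * F i + cst b * G i) i = cst a * rowE F i + cst b * rowE G i"
  unfolding rowE_def pderiv_add pderiv_cst_mult by (simp only: algebra_simps)

lemma eigenfun_rowE:
  assumes "eigenfun z F"
  shows "eigenfun z (rowE F)"
  unfolding eigenfun_def
proof (intro allI impI)
  fix i assume i: "i \<le> l"
  have "rowD (rowE F) i = rowE (rowD F) i" by (rule rowD_rowE_commute)
  also have "\<dots> = rowE (\<lambda>i. cst z * F i + cst 0 * F i) i"
    using assms i by (intro rowE_cong) (auto simp: eigenfun_def cst_hom)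
  also have "\<dots> = cst z * rowE F i" by (simp only: rowE_lincomb) (simp add: cst_hom)
  finally show "rowD (rowE F) i = cst z * rowE F i" .
qed

lemma eigenfun_lincomb:
  assumes "eigenfun z F" "eigenfun z G"
  shows "eigenfun z (\<lambda>i. cst a * F i + cst b * G i)"
  using assms unfolding eigenfun_def rowD_lincomb by (simp add: algebra_simps)

end

section \<open>The operator \<open>E\<close> in coordinates that diagonalise the weight\<close>

text \<open>Conjugation of the Euler operator \<open>u d/du\<close> with \<open>u^i\<close> adds \<open>i\<close>.\<close>

lemma u_pderiv_power_mult:
  "[:0, 1:] * pderiv ([:0, 1:] ^ i * p) = [:0, 1:] ^ i * (of_nat i * p + [:0, 1:] * pderiv p)"
  for p :: "complex poly"
proof (induction i arbitrary: p)
  case (Suc i)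
  have du: "pderiv [:0, 1:] = (1 :: complex poly)" by (simp add: pderiv_pCons)
  have step: "[:0, 1:] * pderiv ([:0, 1:] * q) = [:0, 1:] * (q + [:0, 1:] * pderiv q)" for q :: "complex poly"
    unfolding pderiv_mult du by Groebner_Basis.algebra
  show ?case unfolding power_Suc mult.assoc of_nat_Suc step Suc.IH by Groebner_Basis.algebra
qed simp

lemma one_minus_u_pderiv_power_mult:
  "(1 - [:0, 1:]) * pderiv ((1 - [:0, 1:]) ^ i * p)
   = (1 - [:0, 1:]) ^ i * ((1 - [:0, 1:]) * pderiv p - of_nat i * p)"
  for p :: "complex poly"
proof (induction i arbitrary: p)
  case (Suc i)
  have du: "pderiv (1 - [:0, 1:]) = (- 1 :: complex poly)" by (simp add: pderiv_pCons pderiv_diff one_pCons)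
  have step: "(1 - [:0, 1:]) * pderiv ((1 - [:0, 1:]) * q)
      = (1 - [:0, 1:]) * ((1 - [:0, 1:]) * pderiv q - q)" for q :: "complex poly"
    unfolding pderiv_mult du by Groebner_Basis.algebra
  show ?case unfolding power_Suc mult.assoc of_nat_Suc step Suc.IH by Groebner_Basis.algebra
qed simp

text \<open>The contribution of the component \<open>F\<^sub>i\<close> to the tridiagonal form of \<open>E\<close>, with
  \<open>X = u^i F\<^sub>i\<close>, \<open>Y = u^i u F\<^sub>i'\<close>, \<open>Z = u^i u^2 F\<^sub>i''\<close>, \<open>b = binom(r, i)\<close> and
  \<open>b' = binom(r, i - 1)\<close>. All binomial coefficients of neighbouring indices are expressed by these
  two, so that the absorption identity is the only relation required.\<close>

lemma conjugation_identity:
  fixes a be k l r i u X Y Z b b' :: "'a::idom"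
  assumes "i * b = (r + 1 - i) * b'"
  shows "b * ((1 - u) * ((a - l + 3 * i) * Z)
        + ((a + 2 * l) * (be + 1 + 2 * i) - 3 * k * (l - i) - 3 * i * (be - k + i)) * Y
        - u * ((a - l + 3 * i) * (a + be + l + i + 2)) * Y
        - u * ((a + 2 * l + 3 * k) * (i * (a + be - k + 1 + i))) * X)
     + (r - i) * b * ((1 - u) * (3 * Z) - u * (3 * (i + 1) + 3 * be - 3 * k + 3 + l + 2 * a) * Y)
     + b' * ((l + 1 - i) * (be - k + i) * (3 * Y + (a + 2 * l + 3 * k) * X))
   = (a - l + 3 * r) * ((1 - u) * (b * (i * (i - 1) * X + 2 * i * Y + Z))
        + (be + 1 - u * (a + be + l - r + 2)) * (b * (i * X + Y)))
     + (l - r) * (be - k + 1 + r) * (3 * ((b + b') * (i * X + Y)) + (a + 2 * l + 3 * k - 3 - 3 * r) * (b' * X))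
     + (k + l - r) * (- 3 * (1 - u) * ((r - i) * b * (i * X + Y))
        + (a - 3 * be - 3 * r + 3 * k + 2 * l + u * (2 * a + 3 * be - 3 * k + l + 3)) * (- (i * b * X)))"
  using assms by Groebner_Basis.algebra

lemma pderiv_sum_poly: "pderiv (\<Sum>i\<in>A. f i) = (\<Sum>i\<in>A. pderiv (f i))"
  by (induction A rule: infinite_finite_induct) (simp_all add: pderiv_add)

context jacobi_params begin

text \<open>The coordinates \<open>f\<^sub>r\<close> in which the weight is diagonal: a Pascal matrix applied to \<open>u^i F\<^sub>i\<close>.\<close>

definition pascal :: "(nat \<Rightarrow> complex poly) \<Rightarrow> nat \<Rightarrow> complex poly" where
  "pascal F r = (\<Sum>i\<le>l. of_nat (r choose i) * ([:0, 1:] ^ i * F i))"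

lemma pascal_pderiv:
  "[:0, 1:] * pderiv (pascal F r) =
     (\<Sum>i\<le>l. of_nat (r choose i) * (of_nat i * ([:0, 1:] ^ i * F i) + [:0, 1:] ^ i * ([:0, 1:] * pderiv (F i))))"
proof -
  have d: "pderiv (of_nat n * p) = of_nat n * pderiv p" for n and p :: "complex poly"
    by (simp add: pderiv_mult)
  show ?thesis
    unfolding pascal_def pderiv_sum_poly sum_distrib_left
  proof (rule sum.cong[OF refl])
    fix i
    have "[:0, 1:] * pderiv (of_nat (r choose i) * ([:0, 1:] ^ i * F i))
        = of_nat (r choose i) * ([:0, 1:] * pderiv ([:0, 1:] ^ i * F i))"
      unfolding d by (simp only: ac_simps)
    then show "[:0, 1:] * pderiv (of_nat (r choose i) * ([:0, 1:] ^ i * F i))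
        = of_nat (r choose i) * (of_nat i * ([:0, 1:] ^ i * F i) + [:0, 1:] ^ i * ([:0, 1:] * pderiv (F i)))"
      unfolding u_pderiv_power_mult by (simp only: algebra_simps)
  qed
qed

lemma pascal_pderiv2:
  "[:0, 1:] * ([:0, 1:] * pderiv (pderiv (pascal F r))) =
     (\<Sum>i\<le>l. of_nat (r choose i) * (of_nat i * (of_nat i - 1) * ([:0, 1:] ^ i * F i)
         + 2 * of_nat i * ([:0, 1:] ^ i * ([:0, 1:] * pderiv (F i)))
         + [:0, 1:] ^ i * ([:0, 1:] * ([:0, 1:] * pderiv (pderiv (F i))))))"
proof -
  let ?G = "\<lambda>i. of_nat i * F i + [:0, 1:] * pderiv (F i)"
  have du: "pderiv [:0, 1:] = (1 :: complex poly)" by (simp add: pderiv_pCons)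
  have d: "pderiv (of_nat n * p) = of_nat n * pderiv p" for n and p :: "complex poly"
    by (simp add: pderiv_mult)
  have eq: "[:0, 1:] * pderiv (pascal F r) = pascal ?G r"
    unfolding pascal_pderiv unfolding pascal_def by (simp only: algebra_simps)
  have "[:0, 1:] * ([:0, 1:] * pderiv (pderiv (pascal F r)))
      = [:0, 1:] * pderiv ([:0, 1:] * pderiv (pascal F r)) - [:0, 1:] * pderiv (pascal F r)"
    unfolding pderiv_mult du by Groebner_Basis.algebra
  also have "\<dots> = [:0, 1:] * pderiv (pascal ?G r) - pascal ?G r"
    unfolding eq ..
  also have "\<dots> = (\<Sum>i\<le>l. of_nat (r choose i) * (of_nat i * ([:0, 1:] ^ i * ?G i)
       + [:0, 1:] ^ i * ([:0, 1:] * pderiv (?G i))) - of_nat (r choose i) * ([:0, 1:] ^ i * ?G i))"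
    unfolding pascal_pderiv[of ?G r] unfolding pascal_def sum_subtractf ..
  also have "\<dots> = (\<Sum>i\<le>l. of_nat (r choose i) * (of_nat i * (of_nat i - 1) * ([:0, 1:] ^ i * F i)
         + 2 * of_nat i * ([:0, 1:] ^ i * ([:0, 1:] * pderiv (F i)))
         + [:0, 1:] ^ i * ([:0, 1:] * ([:0, 1:] * pderiv (pderiv (F i))))))"
    unfolding pderiv_add pderiv_mult[of "[:0,1:]"] d du
    by (rule sum.cong[OF refl]) Groebner_Basis.algebra
  finally show ?thesis .
qed

lemma choose_succ: "Suc r choose i = (r choose i) + (if i = 0 then 0 else r choose (i - 1))"
  by (cases i) auto

lemma choose_absorb:
  "of_nat (Suc i) * of_nat (r choose Suc i) = (of_nat r - of_nat i) * (of_nat (r choose i) :: 'a::comm_ring_1)"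
proof (cases "i \<le> r")
  case True
  have "Suc i * (r choose Suc i) = (r - i) * (r choose i)"
    using binomial_absorb_comp[of r i] binomial_absorption[of i r] by (simp add: ac_simps)
  then show ?thesis using True by (metis of_nat_diff of_nat_mult)
qed (simp add: binomial_eq_0)

lemma choose_pred:
  "of_nat r * of_nat ((r - 1) choose i) = (of_nat r - of_nat i) * (of_nat (r choose i) :: 'a::comm_ring_1)"
proof (cases "i \<le> r")
  case True
  have "r * ((r - 1) choose i) = (r - i) * (r choose i)"
    using binomial_absorb_comp[of r i] by simp
  then show ?thesis using True by (metis of_nat_diff of_nat_mult)
next
  case False
  then show ?thesis by (cases "r = 0") (simp_all add: binomial_eq_0)
qed

text \<open>Reindexing of the subdiagonal and superdiagonal terms of \<open>E\<close> by the component of \<open>F\<close> that they contain.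
  No boundary terms appear, as \<open>(r - i) binom(r, i) = 0\<close> at \<open>i = l\<close> for \<open>r \<le> l\<close> and
  \<open>l - i = 0\<close> at \<open>i = l\<close>.\<close>

lemma pascal_shift_down:
  assumes "r \<le> l"
  shows "(\<Sum>i\<le>l. of_nat (r choose i) * (of_nat i * H i (i - 1)))
    = (\<Sum>i\<le>l. (of_nat r - of_nat i) * of_nat (r choose i) * (H (i + 1) i :: complex poly))"
proof -
  have b: "of_nat (r choose Suc i) * of_nat (Suc i) = (of_nat r - of_nat i) * (of_nat (r choose i) :: complex poly)" for i
    using choose_absorb[of i r] by (simp only: mult.commute)
  have "(\<Sum>i\<le>l. of_nat (r choose i) * (of_nat i * H i (i - 1)))
      = (\<Sum>i\<in>{Suc 0..l}. of_nat (r choose i) * (of_nat i * H i (i - 1)))"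
    by (intro sum.mono_neutral_right) auto
  also have "\<dots> = (\<Sum>i<l. of_nat (r choose Suc i) * (of_nat (Suc i) * H (Suc i) i))"
    by (rule sum.reindex_bij_witness[of _ Suc "\<lambda>i. i - 1"]) auto
  also have "\<dots> = (\<Sum>i<l. (of_nat r - of_nat i) * of_nat (r choose i) * H (i + 1) i)"
    by (rule sum.cong[OF refl], unfold mult.assoc[symmetric] b, simp)
  also have "\<dots> = (\<Sum>i\<le>l. (of_nat r - of_nat i) * of_nat (r choose i) * H (i + 1) i)"
    using assms by (intro sum.mono_neutral_left) (auto simp: binomial_eq_0 le_less)
  finally show ?thesis .
qed

lemma pascal_shift_up:
  "(\<Sum>i\<le>l. of_nat (r choose i) * ((of_nat l - of_nat i) * H i (i + 1)))
    = (\<Sum>i\<le>l. of_nat (if i = 0 then 0 else r choose (i - 1)) * ((of_nat l + 1 - of_nat i) * (H (i - 1) i :: complex poly)))"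
proof -
  have "(\<Sum>i\<le>l. of_nat (r choose i) * ((of_nat l - of_nat i) * H i (i + 1)))
      = (\<Sum>i<l. of_nat (r choose i) * ((of_nat l - of_nat i) * H i (i + 1)))"
    by (intro sum.mono_neutral_right) auto
  also have "\<dots> = (\<Sum>i\<in>{Suc 0..l}. of_nat (if i = 0 then 0 else r choose (i - 1)) * ((of_nat l + 1 - of_nat i) * H (i - 1) i))"
    by (rule sum.reindex_bij_witness[of _ "\<lambda>i. i - 1" Suc]) auto
  also have "\<dots> = (\<Sum>i\<le>l. of_nat (if i = 0 then 0 else r choose (i - 1)) * ((of_nat l + 1 - of_nat i) * H (i - 1) i))"
    by (intro sum.mono_neutral_left) auto
  finally show ?thesis .
qed

text \<open>Coefficients of \<open>u E\<close> in the coordinates \<open>f\<^sub>r\<close>: \<open>m_coef\<close> and \<open>n_coef\<close> belong to the neighbours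
  \<open>f\<^sub>r\<^sub>+\<^sub>1\<close> and \<open>f\<^sub>r\<^sub>-\<^sub>1\<close>, the others to their terms of order zero.\<close>

definition m_coef :: "nat \<Rightarrow> real" where "m_coef r = (real l - real r) * (\<beta> - k + 1 + real r)"
definition n_coef :: "nat \<Rightarrow> real" where "n_coef r = real r * (k + real l - real r)"
definition a_coef :: "nat \<Rightarrow> real" where "a_coef r = \<alpha> + 2 * real l + 3 * k - 3 - 3 * real r"
definition s_coef :: "nat \<Rightarrow> real" where "s_coef r = \<alpha> - 3 * \<beta> - 3 * real r + 3 * k + 2 * real l"
definition t_coef :: "real" where "t_coef = 2 * \<alpha> + 3 * \<beta> - 3 * k + real l + 3"

text \<open>The factor \<open>u\<close> on the left clears the denominators that the conjugation introduces. The terms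
  of order zero contain only the differences \<open>f\<^sub>r\<^sub>+\<^sub>1 - f\<^sub>r\<close> and \<open>f\<^sub>r\<^sub>-\<^sub>1 - f\<^sub>r\<close>: \<open>E\<close> annihilates the constant vector
  \<open>e\<^sub>0\<close>, for which all \<open>f\<^sub>r\<close> are equal to \<open>1\<close>.\<close>

lemma pascal_rowE:
  assumes r: "r \<le> l"
  shows "[:0, 1:] * pascal (rowE F) r =
     cst (\<alpha> - real l + 3 * real r) * ((1 - [:0, 1:]) * ([:0, 1:] * ([:0, 1:] * pderiv (pderiv (pascal F r))))
        + (cst (\<beta> + 1) - [:0, 1:] * cst (\<alpha> + \<beta> + real l - real r + 2)) * ([:0, 1:] * pderiv (pascal F r)))
     + cst (m_coef r) * (3 * ([:0, 1:] * pderiv (pascal F (r + 1))) + cst (a_coef r) * (pascal F (r + 1) - pascal F r))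
     + cst (n_coef r) * (- 3 * (1 - [:0, 1:]) * ([:0, 1:] * pderiv (pascal F (r - 1)))
          + (cst (s_coef r) + [:0, 1:] * cst t_coef) * (pascal F (r - 1) - pascal F r))"
proof -
  define u :: "complex poly" where "u = [:0, 1:]"
  define X where "X = (\<lambda>i. u ^ i * F i)"
  define Y where "Y = (\<lambda>i. u ^ i * (u * pderiv (F i)))"
  define Z where "Z = (\<lambda>i. u ^ i * (u * (u * pderiv (pderiv (F i)))))"
  define b where "b = (\<lambda>i. of_nat (r choose i) :: complex poly)"
  define b' where "b' = (\<lambda>i. of_nat (if i = 0 then 0 else r choose (i - 1)) :: complex poly)"
  define a be kk ll rr where "a = cst \<alpha>" and "be = cst \<beta>" and "kk = cst k"
    and "ll = (of_nat l :: complex poly)" and "rr = (of_nat r :: complex poly)"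
  note defs = a_def[symmetric] be_def[symmetric] kk_def[symmetric] ll_def[symmetric] rr_def[symmetric] u_def[symmetric]
  \<comment> \<open>The three summands collect the terms with \<open>F\<^sub>i\<close>, \<open>F\<^sub>i\<^sub>-\<^sub>1\<close> and \<open>F\<^sub>i\<^sub>+\<^sub>1\<close>.\<close>
  have row: "u * (b i * (u ^ i * rowE F i)) =
     b i * ((1 - u) * ((a - ll + 3 * of_nat i) * Z i)
        + ((a + 2 * ll) * (be + 1 + 2 * of_nat i) - 3 * kk * (ll - of_nat i) - 3 * of_nat i * (be - kk + of_nat i)) * Y i
        - u * ((a - ll + 3 * of_nat i) * (a + be + ll + of_nat i + 2)) * Y i
        - u * ((a + 2 * ll + 3 * kk) * (of_nat i * (a + be - kk + 1 + of_nat i))) * X i)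
     + b i * (of_nat i * ((1 - u) * (3 * Z (i - 1)) - u * (3 * of_nat i + 3 * be - 3 * kk + 3 + ll + 2 * a) * Y (i - 1)))
     + b i * ((ll - of_nat i) * ((be - kk + 1 + of_nat i) * (3 * Y (i + 1) + (a + 2 * ll + 3 * kk) * X (i + 1))))" for i
  proof (cases i)
    case 0
    then show ?thesis
      unfolding X_def Y_def Z_def rowE_def cst_hom defs by (simp add: algebra_simps)
  next
    case (Suc m)
    show ?thesis
      unfolding X_def Y_def Z_def rowE_def cst_hom defs Suc diff_Suc_1 power_Suc add_Suc_right add_0_right of_nat_Suc
        Suc_eq_plus1[symmetric]
      by Groebner_Basis.algebra
  qed
  have "u * pascal (rowE F) r = (\<Sum>i\<le>l. u * (b i * (u ^ i * rowE F i)))"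
    unfolding pascal_def b_def u_def sum_distrib_left ..
  also have "\<dots> = (\<Sum>i\<le>l. b i * ((1 - u) * ((a - ll + 3 * of_nat i) * Z i)
        + ((a + 2 * ll) * (be + 1 + 2 * of_nat i) - 3 * kk * (ll - of_nat i) - 3 * of_nat i * (be - kk + of_nat i)) * Y i
        - u * ((a - ll + 3 * of_nat i) * (a + be + ll + of_nat i + 2)) * Y i
        - u * ((a + 2 * ll + 3 * kk) * (of_nat i * (a + be - kk + 1 + of_nat i))) * X i))
     + (\<Sum>i\<le>l. b i * (of_nat i * ((1 - u) * (3 * Z (i - 1)) - u * (3 * of_nat i + 3 * be - 3 * kk + 3 + ll + 2 * a) * Y (i - 1))))
     + (\<Sum>i\<le>l. b i * ((ll - of_nat i) * ((be - kk + 1 + of_nat i) * (3 * Y (i + 1) + (a + 2 * ll + 3 * kk) * X (i + 1)))))"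
    unfolding row sum.distrib ..
  also have "(\<Sum>i\<le>l. b i * (of_nat i * ((1 - u) * (3 * Z (i - 1)) - u * (3 * of_nat i + 3 * be - 3 * kk + 3 +
        ll + 2 * a) * Y (i - 1))))
    = (\<Sum>i\<le>l. (rr - of_nat i) * b i * ((1 - u) * (3 * Z i) - u * (3 * (of_nat i + 1) + 3 * be - 3 * kk + 3 + ll + 2 * a) * Y i))"
    unfolding b_def rr_def
    using pascal_shift_down[OF r, of "\<lambda>i j. (1 - u) * (3 * Z j) - u * (3 * of_nat i + 3 * be - 3 * kk + 3 + ll + 2 * a) * Y j"]
    by (simp only: of_nat_add of_nat_1)
  also have "(\<Sum>i\<le>l. b i * ((ll - of_nat i) * ((be - kk + 1 + of_nat i) * (3 * Y (i + 1) + (a + 2 * ll + 3 * kk) * X (i + 1)))))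
    = (\<Sum>i\<le>l. b' i * ((ll + 1 - of_nat i) * ((be - kk + of_nat i) * (3 * Y i + (a + 2 * ll + 3 * kk) * X i))))"
  proof -
    have eq: "b' i * ((ll + 1 - of_nat i) * ((be - kk + 1 + of_nat (i - 1)) * q)) = b' i * ((ll + 1 - of_nat i) * ((be - kk +
          of_nat i) * q))" for i q
      by (cases i) (simp_all add: b'_def add.assoc)
    show ?thesis
      using pascal_shift_up[of r "\<lambda>i j. (be - kk + 1 + of_nat i) * (3 * Y j + (a + 2 * ll + 3 * kk) * X j)"]
      unfolding b_def b'_def ll_def eq[unfolded b'_def ll_def] .
  qed
  finally have lhs: "u * pascal (rowE F) r = (\<Sum>i\<le>l.
     b i * ((1 - u) * ((a - ll + 3 * of_nat i) * Z i)
        + ((a + 2 * ll) * (be + 1 + 2 * of_nat i) - 3 * kk * (ll - of_nat i) - 3 * of_nat i * (be - kk + of_nat i)) * Y i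
        - u * ((a - ll + 3 * of_nat i) * (a + be + ll + of_nat i + 2)) * Y i
        - u * ((a + 2 * ll + 3 * kk) * (of_nat i * (a + be - kk + 1 + of_nat i))) * X i)
     + (rr - of_nat i) * b i * ((1 - u) * (3 * Z i) - u * (3 * (of_nat i + 1) + 3 * be - 3 * kk + 3 + ll + 2 * a) * Y i)
     + b' i * ((ll + 1 - of_nat i) * (be - kk + of_nat i) * (3 * Y i + (a + 2 * ll + 3 * kk) * X i)))"
    by (simp only: sum.distrib mult.assoc)
  have rel: "of_nat i * b i = (rr + 1 - of_nat i) * b' i" for i
    by (cases i) (simp_all only: b_def b'_def rr_def choose_absorb, simp_all)
  have f0: "pascal F r = (\<Sum>i\<le>l. b i * X i)"
    unfolding pascal_def b_def X_def u_def ..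
  have f1: "u * pderiv (pascal F r) = (\<Sum>i\<le>l. b i * (of_nat i * X i + Y i))"
    unfolding b_def X_def Y_def u_def by (rule pascal_pderiv)
  have f2: "u * (u * pderiv (pderiv (pascal F r))) = (\<Sum>i\<le>l. b i * (of_nat i * (of_nat i - 1) * X i + 2 * of_nat i * Y i + Z i))"
    unfolding b_def X_def Y_def Z_def u_def by (rule pascal_pderiv2)
  have bs: "of_nat (Suc r choose i) = b i + b' i" for i
    unfolding b_def b'_def choose_succ by (simp only: of_nat_add)
  have p0: "pascal F (r + 1) - pascal F r = (\<Sum>i\<le>l. b' i * X i)"
    unfolding f0 unfolding pascal_def Suc_eq_plus1[symmetric] bs unfolding X_def u_def sum_subtractf[symmetric]
    by (simp add: algebra_simps)
  have p1: "u * pderiv (pascal F (r + 1)) = (\<Sum>i\<le>l. (b i + b' i) * (of_nat i * X i + Y i))"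
    unfolding X_def Y_def u_def pascal_pderiv unfolding Suc_eq_plus1[symmetric] bs ..
  have bm: "rr * of_nat ((r - 1) choose i) = (rr - of_nat i) * b i" for i
    unfolding b_def rr_def by (rule choose_pred)
  have m0: "rr * (pascal F (r - 1) - pascal F r) = (\<Sum>i\<le>l. - (of_nat i * b i * X i))"
  proof -
    have "rr * (pascal F (r - 1) - pascal F r) = (\<Sum>i\<le>l. rr * of_nat ((r - 1) choose i) * X i - rr * b i * X i)"
      unfolding f0 unfolding pascal_def X_def u_def right_diff_distrib sum_distrib_left sum_subtractf mult.assoc ..
    then show ?thesis unfolding bm by (simp add: algebra_simps)
  qed
  have m1: "rr * (u * pderiv (pascal F (r - 1))) = (\<Sum>i\<le>l. (rr - of_nat i) * b i * (of_nat i * X i + Y i))"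
    unfolding bm[symmetric] unfolding X_def Y_def u_def pascal_pderiv sum_distrib_left mult.assoc ..
  have main: "u * pascal (rowE F) r =
     (a - ll + 3 * rr) * ((1 - u) * (u * (u * pderiv (pderiv (pascal F r))))
        + (be + 1 - u * (a + be + ll - rr + 2)) * (u * pderiv (pascal F r)))
     + (ll - rr) * (be - kk + 1 + rr) * (3 * (u * pderiv (pascal F (r + 1)))
         + (a + 2 * ll + 3 * kk - 3 - 3 * rr) * (pascal F (r + 1) - pascal F r))
     + (kk + ll - rr) * (- 3 * (1 - u) * (rr * (u * pderiv (pascal F (r - 1))))
          + (a - 3 * be - 3 * rr + 3 * kk + 2 * ll + u * (2 * a + 3 * be - 3 * kk + ll + 3)) * (rr * (pascal F (r - 1) - pascal F r)))"
    unfolding lhs conjugation_identity[OF rel] f1 f2 p0 p1 m0 m1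
    by (simp only: sum_distrib_left sum.distrib[symmetric])
  show ?thesis
    unfolding m_coef_def n_coef_def a_coef_def s_coef_def t_coef_def cst_hom defs main
    by Groebner_Basis.algebra
qed

end

section \<open>Symmetry of \<open>E\<close> at the level of densities\<close>

context jacobi_params begin

text \<open>The weights \<open>c\<^sub>r\<close> of the diagonal form of \<open>W\<close>, and the recurrence that makes the off-diagonal entries
  of \<open>E\<close> adjoint to each other.\<close>

definition c_coef :: "nat \<Rightarrow> real" where
  "c_coef r = ((real l + k - real r - 1) gchoose (l - r)) * ((\<beta> - k + real r) gchoose r)"

lemma c_coef_rec:
  assumes "r < l"
  shows "c_coef (r + 1) * n_coef (r + 1) = c_coef r * m_coef r"
proof -
  define m where "m = l - r - 1"
  have m: "l - r = Suc m" "l - (r + 1) = m" "real l = real r + real m + 1"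
    using assms of_nat_diff[of "Suc r" l, where 'a = real] by (auto simp: m_def)
  have 1: "real (Suc m) * ((k + real m) gchoose Suc m) = (k + real m) * ((k + real m - 1) gchoose m)"
    by (rule gbinomial_absorption)
  have 2: "real (Suc r) * ((\<beta> - k + real r + 1) gchoose Suc r) = (\<beta> - k + real r + 1) * ((\<beta> - k + real r) gchoose r)"
    using gbinomial_absorption[of r "\<beta> - k + real r + 1"] by simp
  have cr: "c_coef r = ((k + real m) gchoose Suc m) * ((\<beta> - k + real r) gchoose r)"
    unfolding c_coef_def m by (simp add: algebra_simps)
  have cr1: "c_coef (r + 1) = ((k + real m - 1) gchoose m) * ((\<beta> - k + real r + 1) gchoose Suc r)"
    unfolding c_coef_def m by (simp add: algebra_simps)
  have n: "n_coef (r + 1) = real (Suc r) * (k + real m)"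
    unfolding n_coef_def m by simp
  have m': "m_coef r = real (Suc m) * (\<beta> - k + real r + 1)"
    unfolding m_coef_def m by (simp add: algebra_simps)
  have "c_coef (r + 1) * n_coef (r + 1)
      = ((k + real m) * ((k + real m - 1) gchoose m)) * (real (Suc r) * ((\<beta> - k + real r + 1) gchoose Suc r))"
    unfolding cr1 n by (simp only: ac_simps)
  also have "\<dots> = c_coef r * m_coef r"
    unfolding 1[symmetric] 2 cr m' by (simp only: ac_simps)
  finally show ?thesis .
qed

text \<open>The bilinear density of the inner product without the scalar factor \<open>(1 - u)^\<alpha> u^\<beta>\<close>. Complex
  conjugation of the second argument is applied by its users.\<close>

definition form_density :: "(nat \<Rightarrow> complex poly) \<Rightarrow> (nat \<Rightarrow> complex poly) \<Rightarrow> complex poly" where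
  "form_density F G = (\<Sum>r\<le>l. cst (c_coef r) * (1 - [:0, 1:]) ^ (l - r) * (pascal F r * pascal G r))"

text \<open>With \<open>\<omega> = (1 - u)^\<alpha> u^\<beta>\<close> the derivative of \<open>\<omega> u (1 - u) K\<close> is \<open>\<omega>\<close> times this polynomial. The
  function \<open>\<omega> u (1 - u) K\<close> vanishes at \<open>0\<close> and \<open>1\<close>, so these polynomials have integral \<open>0\<close>
  against \<open>\<omega>\<close>.\<close>

definition weighted_deriv :: "complex poly \<Rightarrow> complex poly" where
  "weighted_deriv K = (cst (\<beta> + 1) * (1 - [:0, 1:]) - cst (\<alpha> + 1) * [:0, 1:]) * K
     + [:0, 1:] * (1 - [:0, 1:]) * pderiv K"

lemma weighted_deriv_add: "weighted_deriv (p + q) = weighted_deriv p + weighted_deriv q"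
  unfolding weighted_deriv_def pderiv_add by (simp only: algebra_simps)

lemma weighted_deriv_0: "weighted_deriv 0 = 0"
  by (simp add: weighted_deriv_def)

lemma weighted_deriv_sum: "weighted_deriv (\<Sum>i\<in>A. p i) = (\<Sum>i\<in>A. weighted_deriv (p i))"
  by (induction A rule: infinite_finite_induct) (simp_all add: weighted_deriv_0 weighted_deriv_add)

lemma weighted_deriv_power:
  "weighted_deriv (cst c * ((1 - [:0, 1:]) ^ m * p)) =
     cst c * (1 - [:0, 1:]) ^ m * ((cst (\<beta> + 1) * (1 - [:0, 1:]) - cst (\<alpha> + 1 + real m) * [:0, 1:]) * p
        + [:0, 1:] * (1 - [:0, 1:]) * pderiv p)"
proof -
  have "[:0, 1:] * (1 - [:0, 1:]) * pderiv (cst c * ((1 - [:0, 1:]) ^ m * p))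
      = [:0, 1:] * cst c * ((1 - [:0, 1:]) * pderiv ((1 - [:0, 1:]) ^ m * p))"
    unfolding pderiv_cst_mult by (simp only: ac_simps)
  then have eq: "[:0, 1:] * (1 - [:0, 1:]) * pderiv (cst c * ((1 - [:0, 1:]) ^ m * p))
      = [:0, 1:] * cst c * ((1 - [:0, 1:]) ^ m * ((1 - [:0, 1:]) * pderiv p - of_nat m * p))"
    unfolding one_minus_u_pderiv_power_mult .
  show ?thesis
    unfolding weighted_deriv_def eq cst_hom by Groebner_Basis.algebra
qed

text \<open>Lagrange's identity: the antisymmetric part of the pairing with a Jacobi operator is the derivative of the
  weighted Wronskian.\<close>

lemma weighted_deriv_diagonal:
  "[:0, 1:] * weighted_deriv (cst c * ((1 - [:0, 1:]) ^ m * (pderiv f * g - f * pderiv g))) =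
     cst c * (1 - [:0, 1:]) ^ m *
       (((1 - [:0, 1:]) * ([:0, 1:] * ([:0, 1:] * pderiv (pderiv f)))
          + (cst (\<beta> + 1) - [:0, 1:] * cst (\<alpha> + \<beta> + real m + 2)) * ([:0, 1:] * pderiv f)) * g
        - ((1 - [:0, 1:]) * ([:0, 1:] * ([:0, 1:] * pderiv (pderiv g)))
          + (cst (\<beta> + 1) - [:0, 1:] * cst (\<alpha> + \<beta> + real m + 2)) * ([:0, 1:] * pderiv g)) * f)"
  unfolding weighted_deriv_power unfolding cst_hom pderiv_diff pderiv_mult by Groebner_Basis.algebra

text \<open>The entries at \<open>(r, r + 1)\<close> and \<open>(r + 1, r)\<close> together are a derivative, here with \<open>f0 = f\<^sub>r\<close>,
  \<open>f1 = f\<^sub>r\<^sub>+\<^sub>1\<close> and \<open>m = l - r - 1\<close>. The two conditions on \<open>a\<close>, \<open>s\<close>, \<open>t\<close> say that the terms of order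
  zero combine to three times the logarithmic derivative of \<open>u^\<beta> (1 - u)^(\<alpha> + m + 1)\<close>, cleared of its
  denominators.\<close>

lemma weighted_deriv_offdiagonal:
  assumes H: "[:0, 1:] * H = f1 * g0 - f0 * g1"
    and as: "a - s = 3 * \<beta>" and at: "a + t = 3 * (\<alpha> + \<beta> + real m + 1)"
  shows "[:0, 1:] * weighted_deriv (cst (3 * c) * ((1 - [:0, 1:]) ^ m * H)) =
     cst c * (1 - [:0, 1:]) ^ (m + 1) *
       ((3 * ([:0, 1:] * pderiv f1) + cst a * f1) * g0 - (3 * ([:0, 1:] * pderiv g1) + cst a * g1) * f0)
   + cst c * (1 - [:0, 1:]) ^ m *
       ((- 3 * (1 - [:0, 1:]) * ([:0, 1:] * pderiv f0) + (cst s + [:0, 1:] * cst t) * f0) * g1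
        - (- 3 * (1 - [:0, 1:]) * ([:0, 1:] * pderiv g0) + (cst s + [:0, 1:] * cst t) * g0) * f1)"
proof -
  have du: "pderiv [:0, 1:] = (1 :: complex poly)" by (simp add: pderiv_pCons)
  have "pderiv ([:0, 1:] * H) = pderiv (f1 * g0 - f0 * g1)" by (simp only: H)
  then have dH: "[:0, 1:] * pderiv H = pderiv f1 * g0 + f1 * pderiv g0 - pderiv f0 * g1 - f0 * pderiv g1 - H"
    unfolding pderiv_mult pderiv_diff du by Groebner_Basis.algebra
  have s: "s = a - 3 * \<beta>" and t: "t = 3 * (\<alpha> + \<beta> + real m + 1) - a" using as at by auto
  define v where "v = (1 - [:0, 1:] :: complex poly) ^ m"
  have p: "(1 - [:0, 1:] :: complex poly) ^ (m + 1) = (1 - [:0, 1:]) * v" by (simp add: v_def)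
  show ?thesis
    unfolding weighted_deriv_power unfolding p v_def[symmetric] s t cst_hom
    using H dH by Groebner_Basis.algebra
qed

lemma poly_pascal_0: "poly (pascal F r) 0 = poly (F 0) 0"
proof -
  have "poly (pascal F r) 0 = (\<Sum>i\<le>l. if i = 0 then poly (F 0) 0 else 0)"
    unfolding pascal_def poly_sum by (rule sum.cong) (auto simp: poly_power)
  then show ?thesis by simp
qed

text \<open>Diagonal and off-diagonal parts are treated separately. The boundary term of the off-diagonal part,
  \<open>f\<^sub>r\<^sub>+\<^sub>1 g\<^sub>r - f\<^sub>r g\<^sub>r\<^sub>+\<^sub>1\<close>, carries no visible factor \<open>u\<close>; it is divisible by \<open>u\<close> because
  all \<open>f\<^sub>r\<close> have the same value \<open>F\<^sub>0(0)\<close> at \<open>0\<close>.\<close>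

lemma form_density_rowE_symmetric:
  "\<exists>K. form_density (rowE F) G - form_density F (rowE G) = weighted_deriv K"
proof -
  define u :: "complex poly" where "u = [:0, 1:]"
  define f where "f = pascal F"
  define g where "g = pascal G"
  define c where "c = (\<lambda>r. cst (c_coef r))"
  define H where "H = (\<lambda>r. (f (r + 1) * g r - f r * g (r + 1)) div u)"
  have H: "u * H r = f (r + 1) * g r - f r * g (r + 1)" for r
  proof -
    have "poly (f (r + 1) * g r - f r * g (r + 1)) 0 = 0"
      unfolding f_def g_def by (simp add: poly_pascal_0)
    then have "u dvd f (r + 1) * g r - f r * g (r + 1)"
      unfolding poly_eq_0_iff_dvd u_def by simp
    then show ?thesis unfolding H_def by simp
  qed
  define S where "S = (\<lambda>f r. (1 - u) * (u * (u * pderiv (pderiv (f r))))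
        + (cst (\<beta> + 1) - u * cst (\<alpha> + \<beta> + real l - real r + 2)) * (u * pderiv (f r)))"
  define U where "U = (\<lambda>f r. 3 * (u * pderiv (f (r + 1))) + cst (a_coef r) * (f (r + 1) :: complex poly))"
  define L where "L = (\<lambda>f r. - 3 * (1 - u) * (u * pderiv (f (r - 1))) + (cst (s_coef r) +
        u * cst t_coef) * (f (r - 1) :: complex poly))"
  define Sd where "Sd = (\<lambda>r. c r * cst (\<alpha> - real l + 3 * real r) * (1 - u) ^ (l - r) * (S f r * g r - S g r * f r))"
  define Ud where "Ud = (\<lambda>r. c r * cst (m_coef r) * (1 - u) ^ (l - r) * (U f r * g r - U g r * f r))"
  define Ld where "Ld = (\<lambda>r. c r * cst (n_coef r) * (1 - u) ^ (l - r) * (L f r * g r - L g r * f r))"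
  have row: "u * pascal (rowE F) r = cst (\<alpha> - real l + 3 * real r) * S (pascal F) r
       + cst (m_coef r) * (U (pascal F) r - cst (a_coef r) * pascal F r)
       + cst (n_coef r) * (L (pascal F) r - (cst (s_coef r) + u * cst t_coef) * pascal F r)" if "r \<le> l" for F r
    unfolding u_def pascal_rowE[OF that] S_def U_def L_def by Groebner_Basis.algebra
  have "u * (form_density (rowE F) G - form_density F (rowE G))
      = (\<Sum>r\<le>l. c r * (1 - u) ^ (l - r) * ((u * pascal (rowE F) r) * g r - f r * (u * pascal (rowE G) r)))"
    unfolding form_density_def right_diff_distrib sum_distrib_left sum_subtractf c_def f_def g_def u_def
    by (simp only: ac_simps)
  also have "\<dots> = (\<Sum>r\<le>l. Sd r + Ud r + Ld r)"
  proof (rule sum.cong[OF refl])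
    fix r assume "r \<in> {..l}"
    then have r: "r \<le> l" by simp
    show "c r * (1 - u) ^ (l - r) * ((u * pascal (rowE F) r) * g r - f r * (u * pascal (rowE G) r)) = Sd r + Ud r + Ld r"
      unfolding row[OF r] Sd_def Ud_def Ld_def f_def[symmetric] g_def[symmetric]
      by Groebner_Basis.algebra
  qed
  also have "\<dots> = (\<Sum>r\<le>l. Sd r) + (\<Sum>r<l. Ud r) + (\<Sum>r<l. Ld (r + 1))"
  proof -
    have "(\<Sum>r\<le>l. Ud r) = (\<Sum>r<l. Ud r)"
      by (simp add: lessThan_Suc_atMost[symmetric] Ud_def m_coef_def cst_hom)
    moreover have "(\<Sum>r\<le>l. Ld r) = (\<Sum>r<l. Ld (r + 1))"
      using sum.lessThan_Suc_shift[of Ld l]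
      by (simp add: lessThan_Suc_atMost[symmetric] Ld_def n_coef_def cst_hom del: sum.lessThan_Suc)
    ultimately show ?thesis by (simp add: sum.distrib)
  qed
  also have "\<dots> = (\<Sum>r\<le>l. Sd r) + (\<Sum>r<l. Ud r + Ld (r + 1))"
    by (simp add: sum.distrib)
  also have "(\<Sum>r\<le>l. Sd r) = (\<Sum>r\<le>l. u * weighted_deriv (cst (c_coef r * (\<alpha> - real l + 3 * real r))
      * ((1 - u) ^ (l - r) * (pderiv (f r) * g r - f r * pderiv (g r)))))"
  proof (rule sum.cong[OF refl])
    fix r assume "r \<in> {..l}"
    then have r: "\<alpha> + \<beta> + real (l - r) + 2 = \<alpha> + \<beta> + real l - real r + 2" by (simp add: of_nat_diff)
    show "Sd r = u * weighted_deriv (cst (c_coef r * (\<alpha> - real l + 3 * real r))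
      * ((1 - u) ^ (l - r) * (pderiv (f r) * g r - f r * pderiv (g r))))"
      unfolding u_def weighted_deriv_diagonal r unfolding Sd_def S_def c_def cst_hom(3) u_def ..
  qed
  also have "(\<Sum>r<l. Ud r + Ld (r + 1)) = (\<Sum>r<l. u * weighted_deriv (cst (3 * (c_coef r * m_coef r)) * ((1 - u) ^ (l -
        r - 1) * H r)))"
  proof (rule sum.cong[OF refl])
    fix r assume "r \<in> {..<l}"
    then have r: "r < l" by simp
    have as: "a_coef r - s_coef (r + 1) = 3 * \<beta>"
      by (simp add: a_coef_def s_coef_def)
    have at: "a_coef r + t_coef = 3 * (\<alpha> + \<beta> + real (l - r - 1) + 1)"
      using r of_nat_diff[of "Suc r" l, where 'a = real] by (simp add: a_coef_def t_coef_def)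
    have pw: "l - r - 1 + 1 = l - r" "l - (r + 1) = l - r - 1" using r by auto
    have "Ud r + Ld (r + 1) = cst (c_coef r * m_coef r) * (1 - u) ^ (l - r - 1 + 1) * (U f r * g r - U g r * f r)
      + cst (c_coef r * m_coef r) * (1 - u) ^ (l - r - 1) * (L f (r + 1) * g (r + 1) - L g (r + 1) * f (r + 1))"
      unfolding Ud_def Ld_def c_def cst_hom(3)[symmetric] c_coef_rec[OF r] pw ..
    also have "\<dots> = u * weighted_deriv (cst (3 * (c_coef r * m_coef r)) * ((1 - u) ^ (l - r - 1) * H r))"
      unfolding u_def weighted_deriv_offdiagonal[OF H[unfolded u_def] as at] unfolding U_def L_def u_def diff_add_inverse2 ..
    finally show "Ud r + Ld (r + 1) = u * weighted_deriv (cst (3 * (c_coef r * m_coef r)) * ((1 - u) ^ (l - r - 1) * H r))" .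
  qed
  finally have "u * (form_density (rowE F) G - form_density F (rowE G)) = u * weighted_deriv (
     (\<Sum>r\<le>l. cst (c_coef r * (\<alpha> - real l + 3 * real r))
      * ((1 - u) ^ (l - r) * (pderiv (f r) * g r - f r * pderiv (g r))))
     + (\<Sum>r<l. cst (3 * (c_coef r * m_coef r)) * ((1 - u) ^ (l - r - 1) * H r)))"
    unfolding weighted_deriv_add weighted_deriv_sum distrib_left sum_distrib_left .
  moreover have "u \<noteq> 0" by (simp add: u_def)
  ultimately show ?thesis by auto
qed

end

section \<open>The inner product\<close>

definition jacobi_weight :: "real \<Rightarrow> real \<Rightarrow> real \<Rightarrow> real" where
  "jacobi_weight a b x = (1 - x) powr a * x powr b"

text \<open>Since \<open>x * x powr b = x powr (b + 1)\<close>, integrability follows by induction on the polynomial with \<open>b\<close>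
  arbitrary; the constants are Beta integrals.\<close>

lemma jacobi_weight_poly_integrable:
  assumes "a > -1" "b > -1"
  shows "(\<lambda>x. complex_of_real (jacobi_weight a b x) * poly p (of_real x)) integrable_on {0<..<1}"
  using assms(2)
proof (induction p arbitrary: b)
  case 0
  show ?case by (simp add: integrable_0)
next
  case (pCons c p)
  have "((\<lambda>t. t powr (b + 1 - 1) * (1 - t) powr (a + 1 - 1)) has_integral Beta (b + 1) (a + 1)) {0<..<1}"
    using has_integral_Beta_real[of "b + 1" "a + 1"] assms(1) pCons.prems
    unfolding has_integral_Icc_iff_Ioo by simp
  then have "jacobi_weight a b integrable_on {0<..<1}"
    unfolding jacobi_weight_def by (auto simp: mult.commute integrable_on_def)
  from integrable_linear[OF integrable_linear[OF this bounded_linear_of_real] bounded_linear_mult_left[of c]]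
  have 1: "(\<lambda>x. complex_of_real (jacobi_weight a b x) * c) integrable_on {0<..<1}"
    by (simp add: o_def)
  have 2: "(\<lambda>x. complex_of_real (jacobi_weight a (b + 1) x) * poly p (of_real x)) integrable_on {0<..<1}"
    using pCons.IH[of "b + 1"] pCons.prems by simp
  show ?case
    by (rule integrable_eq[OF integrable_add[OF 1 2]])
      (simp add: jacobi_weight_def powr_add algebra_simps)
qed

locale jacobi = jacobi_params +
  assumes alpha: "\<alpha> > -1" and beta: "\<beta> > -1" and k_pos: "0 < k" and k_less: "k < \<beta> + 1" and l_pos: "l \<ge> 1"
begin

definition weighted :: "complex poly \<Rightarrow> real \<Rightarrow> complex" where
  "weighted p x = complex_of_real (jacobi_weight \<alpha> \<beta> x) * poly p (of_real x)"

lemma weighted_integrable: "weighted p integrable_on {0<..<1}"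
  using jacobi_weight_poly_integrable[OF alpha beta, of p] by (simp add: weighted_def[abs_def])

lemma integral_weighted_deriv: "integral {0<..<1} (weighted (weighted_deriv K)) = 0"
proof -
  let ?H = "\<lambda>x. complex_of_real (x powr (\<beta> + 1) * (1 - x) powr (\<alpha> + 1)) * poly K (of_real x)"
  have "(weighted (weighted_deriv K) has_integral (?H 1 - ?H 0)) {0..1}"
  proof (rule fundamental_theorem_of_calculus_interior)
    show "continuous_on {0..1} ?H"
      using alpha beta by (intro continuous_intros continuous_on_powr') auto
    fix x :: real assume "x \<in> {0<..<1}"
    then have x: "0 < x" "x < 1" by auto
    have "((\<lambda>x. x powr (\<beta> + 1)) has_real_derivative (\<beta> + 1) * x powr \<beta>) (at x)"
      using has_real_derivative_powr[of x "\<beta> + 1"] x by simp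
    moreover have "((\<lambda>x. 1 - x) has_real_derivative - 1) (at x)"
      by (auto intro!: derivative_eq_intros)
    then have "((\<lambda>x. (1 - x) powr (\<alpha> + 1)) has_real_derivative (\<alpha> + 1) * (1 - x) powr \<alpha> * - 1) (at x)"
      using has_real_derivative_powr[of "1 - x" "\<alpha> + 1"] x
      by (intro DERIV_chain2[where f = "\<lambda>z. z powr (\<alpha> + 1)" and g = "\<lambda>x. 1 - x"]) auto
    ultimately have "((\<lambda>x. x powr (\<beta> + 1) * (1 - x) powr (\<alpha> + 1)) has_real_derivative
       (\<beta> + 1) * x powr \<beta> * (1 - x) powr (\<alpha> + 1)
         + (\<alpha> + 1) * (1 - x) powr \<alpha> * - 1 * x powr (\<beta> + 1)) (at x)"
      by (rule DERIV_mult)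
    from has_vector_derivative_mult[OF has_vector_derivative_of_real[OF this]
        has_vector_derivative_real_field[OF poly_DERIV[of K "of_real x"]]]
    show "(?H has_vector_derivative weighted (weighted_deriv K) x) (at x)"
      using x by (simp add: weighted_def weighted_deriv_def cst_def jacobi_weight_def powr_add algebra_simps)
  qed simp
  moreover have "?H 1 - ?H 0 = 0" using alpha beta by simp
  ultimately show ?thesis unfolding has_integral_Icc_iff_Ioo by (simp add: integral_unique)
qed

definition inner_W :: "(nat \<Rightarrow> complex poly) \<Rightarrow> (nat \<Rightarrow> complex poly) \<Rightarrow> complex" where
  "inner_W F G = integral {0<..<1} (weighted (form_density F G))"

lemma inner_W_rowE: "inner_W (rowE F) G = inner_W F (rowE G)"
proof -
  obtain K where K: "form_density (rowE F) G - form_density F (rowE G) = weighted_deriv K"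
    using form_density_rowE_symmetric by blast
  have "inner_W (rowE F) G - inner_W F (rowE G) = integral {0<..<1} (weighted (weighted_deriv K))"
    unfolding inner_W_def K[symmetric] integral_diff[OF weighted_integrable weighted_integrable, symmetric]
    by (simp add: weighted_def[abs_def] algebra_simps)
  then show ?thesis by (simp add: integral_weighted_deriv)
qed

lemma pascal_lincomb: "pascal (\<lambda>i. cst a * F i + cst b * G i) r = cst a * pascal F r + cst b * pascal G r"
  unfolding pascal_def sum_distrib_left sum.distrib[symmetric] by (rule sum.cong) (simp_all only: algebra_simps)

lemma inner_W_lincomb:
  "inner_W (\<lambda>i. cst a * F i + cst b * G i) H = of_real a * inner_W F H + of_real b * inner_W G H"
proof -
  have "form_density (\<lambda>i. cst a * F i + cst b * G i) H = cst a * form_density F H + cst b * form_density G H"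
    unfolding form_density_def pascal_lincomb sum_distrib_left sum.distrib[symmetric]
    by (rule sum.cong) (simp_all only: algebra_simps)
  then have eq: "weighted (form_density (\<lambda>i. cst a * F i + cst b * G i) H)
      = (\<lambda>x. of_real a * weighted (form_density F H) x + of_real b * weighted (form_density G H) x)"
    by (auto simp: weighted_def cst_def algebra_simps)
  have int: "(\<lambda>x. c * weighted p x) integrable_on {0<..<1}" for c p
    using integrable_linear[OF weighted_integrable bounded_linear_mult_right, of c p] by (simp add: o_def)
  have val: "integral {0<..<1} (\<lambda>x. c * weighted p x) = c * integral {0<..<1} (weighted p)" for c p
    using integral_linear[OF weighted_integrable bounded_linear_mult_right, of c p] by (simp add: o_def)
  show ?thesis
    unfolding inner_W_def eq by (simp add: integral_add int val)
qed

abbreviation (input) conj_fun :: "(nat \<Rightarrow> complex poly) \<Rightarrow> nat \<Rightarrow> complex poly" where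
  "conj_fun F \<equiv> \<lambda>i. map_poly cnj (F i)"

lemma rowE_conj: "rowE (conj_fun F) i = map_poly cnj (rowE F i)"
  by (rule poly_eqI) (simp add: coeff_rowE coeff_map_poly E_coeff_def)

lemma poly_pascal: "poly (pascal F r) x = (\<Sum>i\<le>l. of_nat (r choose i) * x ^ i * poly (F i) x)"
  unfolding pascal_def poly_sum by (rule sum.cong) (simp_all add: poly_power)

lemma poly_pascal_conj: "poly (pascal (conj_fun F) r) (of_real x) = cnj (poly (pascal F r) (of_real x))"
  by (simp add: poly_pascal)

lemma poly_form_density:
  "poly (form_density F G) (of_real x) =
    (\<Sum>r\<le>l. of_real (c_coef r * (1 - x) ^ (l - r)) * (poly (pascal F r) (of_real x) * poly (pascal G r) (of_real x)))"
  unfolding form_density_def poly_sum by (rule sum.cong) (simp_all add: cst_def poly_power)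

lemma c_coef_pos:
  assumes "r \<le> l"
  shows "c_coef r > 0"
proof -
  have "real l + k - real r - 1 - real (l - r) + 1 = k" using assms by (simp add: of_nat_diff)
  then have 1: "(real l + k - real r - 1) gchoose (l - r) = pochhammer k (l - r) / fact (l - r)"
    by (simp add: gbinomial_pochhammer')
  have 2: "(\<beta> - k + real r) gchoose r = pochhammer (\<beta> - k + 1) r / fact r"
    by (simp add: gbinomial_pochhammer')
  show ?thesis
    unfolding c_coef_def 1 2 using k_pos k_less by (intro mult_pos_pos divide_pos_pos pochhammer_pos) auto
qed

text \<open>The Pascal matrix is unitriangular.\<close>

lemma pascal_eq_0_imp:
  assumes "\<And>r. r \<le> l \<Longrightarrow> pascal F r = 0" and "i \<le> l"
  shows "F i = 0"
  using assms(2)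
proof (induction i rule: less_induct)
  case (less i)
  have "pascal F i = (\<Sum>j\<le>l. if j = i then [:0, 1:] ^ i * F i else 0)"
    unfolding pascal_def
  proof (rule sum.cong[OF refl])
    fix j assume "j \<in> {..l}"
    then show "of_nat (i choose j) * ([:0, 1:] ^ j * F j) = (if j = i then [:0, 1:] ^ i * F i else 0)"
      using less.IH[of j] by (cases j i rule: linorder_cases) (auto simp: binomial_eq_0)
  qed
  then have "[:0, 1:] ^ i * F i = 0" using assms(1)[OF less.prems] less.prems by simp
  then show ?case by simp
qed

text \<open>The integrand of \<open>\<langle>F, F\<rangle>\<close> is a nonnegative combination of the \<open>\<bar>f\<^sub>r\<bar>^2\<close>. It is continuous only on the
  open interval, so its vanishing is deduced on compact subintervals; each \<open>f\<^sub>r\<close> then has infinitely many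
  zeros.\<close>

lemma inner_W_definite:
  assumes "inner_W F (conj_fun F) = 0" and "i \<le> l"
  shows "F i = 0"
proof (rule pascal_eq_0_imp[OF _ assms(2)])
  define S where "S = (\<lambda>x. \<Sum>r\<le>l. c_coef r * (1 - x) ^ (l - r) * (cmod (poly (pascal F r) (of_real x)))\<^sup>2)"
  define \<phi> where "\<phi> = (\<lambda>x. jacobi_weight \<alpha> \<beta> x * S x)"
  have eq: "weighted (form_density F (conj_fun F)) = (\<lambda>x. of_real (\<phi> x))"
    unfolding weighted_def poly_form_density poly_pascal_conj complex_norm_square[symmetric] \<phi>_def S_def by simp
  have "\<phi> = Re \<circ> weighted (form_density F (conj_fun F))" unfolding eq by auto
  then have int: "\<phi> integrable_on {0<..<1}" and int0: "integral {0<..<1} \<phi> = 0"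
    using integrable_linear[OF weighted_integrable bounded_linear_Re]
      integral_linear[OF weighted_integrable bounded_linear_Re] assms(1)
    by (simp_all add: inner_W_def)
  have term_nonneg: "0 \<le> c_coef r * (1 - x) ^ (l - r) * (cmod (poly (pascal F r) (of_real x)))\<^sup>2"
    if "x \<in> {0<..<1}" "r \<le> l" for x r
    using c_coef_pos[OF that(2)] that(1) by (intro mult_nonneg_nonneg) auto
  have nonneg: "0 \<le> \<phi> x" if "x \<in> {0<..<1}" for x
  proof -
    have "0 \<le> S x" unfolding S_def by (intro sum_nonneg term_nonneg[OF that]) simp
    then show ?thesis by (simp add: \<phi>_def jacobi_weight_def)
  qed
  have zero: "\<phi> x = 0" if x: "x \<in> {0<..<1}" for x
  proof -
    let ?I = "{x / 2..(1 + x) / 2}"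
    have sub: "?I \<subseteq> {0<..<1}" using x by auto
    have "integral ?I \<phi> \<le> integral {0<..<1} \<phi>"
      using sub int nonneg by (intro integral_subset_le integrable_on_subinterval[OF int sub]) auto
    moreover have "0 \<le> integral ?I \<phi>"
      using sub nonneg by (intro integral_nonneg integrable_on_subinterval[OF int sub]) auto
    ultimately have "integral ?I \<phi> = 0" using int0 by simp
    moreover have "continuous_on ?I \<phi>"
      unfolding \<phi>_def S_def jacobi_weight_def
      using x by (intro continuous_intros) auto
    moreover have "x / 2 < (1 + x) / 2" by simp
    moreover have "\<And>y. y \<in> ?I \<Longrightarrow> 0 \<le> \<phi> y" using nonneg sub by blast
    ultimately have "\<forall>y\<in>?I. \<phi> y = 0"
      using integral_eq_0_iff by blast
    then show ?thesis using x by simp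
  qed
  fix r assume r: "r \<le> l"
  have root: "poly (pascal F r) (of_real x) = 0" if x: "x \<in> {0<..<1}" for x
  proof -
    have "S x = 0" using zero[OF x] x by (simp add: \<phi>_def jacobi_weight_def)
    then have "c_coef r * (1 - x) ^ (l - r) * (cmod (poly (pascal F r) (of_real x)))\<^sup>2 = 0"
      unfolding S_def using term_nonneg[OF x] r by (subst (asm) sum_nonneg_eq_0_iff) auto
    then show ?thesis using c_coef_pos[OF r] x by simp
  qed
  show "pascal F r = 0"
  proof (rule ccontr)
    assume "pascal F r \<noteq> 0"
    then have "finite {z. poly (pascal F r) z = 0}" by (rule poly_roots_finite)
    moreover have "complex_of_real ` {0<..<1} \<subseteq> {z. poly (pascal F r) z = 0}" using root by auto
    ultimately have "finite (complex_of_real ` {0<..<1})" by (rule finite_subset[rotated])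
    then have "finite {0<..<1::real}" by (rule finite_imageD) (auto intro: inj_onI)
    then show False by (simp add: infinite_Ioo)
  qed
qed

text \<open>The sum over \<open>r\<close> in the definition of the weight is the diagonal form in the coordinates \<open>f\<^sub>r\<close>.\<close>

lemma weightW_form:
  assumes "F \<in> carrier_vec (l + 1)" "G \<in> carrier_vec (l + 1)"
  shows "(weightW \<alpha> \<beta> k l x *\<^sub>v eval_vec F x) \<bullet>c eval_vec G x
    = weighted (form_density (vec_index F) (conj_fun (vec_index G))) x"
proof -
  let ?w = "complex_of_real (jacobi_weight \<alpha> \<beta> x)"
  define c where "c = (\<lambda>r. complex_of_real (c_coef r * (1 - x) ^ (l - r)))"
  define f where "f = (\<lambda>r i. complex_of_real (real (r choose i) * x ^ i) * poly (F $ i) (of_real x))"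
  define g where "g = (\<lambda>r i. complex_of_real (real (r choose i) * x ^ i) * cnj (poly (G $ i) (of_real x)))"
  have "(weightW \<alpha> \<beta> k l x *\<^sub>v eval_vec F x) \<bullet>c eval_vec G x
     = (\<Sum>i\<le>l. (\<Sum>j\<le>l. ?w * (\<Sum>r\<le>l. complex_of_real (real (r choose i) * real (r choose j)
       * ((real l + k - real r - 1) gchoose (l - r)) * ((\<beta> - k + real r) gchoose r)
       * (1 - x) ^ (l - r) * x ^ (i + j))) * poly (F $ j) (of_real x)) * cnj (poly (G $ i) (of_real x)))"
    using assms
    by (simp add: weightW_def weightZ_def real_mat_def eval_vec_def scalar_prod_def jacobi_weight_def
        atLeast0LessThan lessThan_Suc_atMost atLeast0AtMost of_real_sum)
  also have "\<dots> = (\<Sum>i\<le>l. \<Sum>j\<le>l. \<Sum>r\<le>l. ?w * (c r * (f r j * g r i)))"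
    unfolding sum_distrib_left sum_distrib_right
    by (intro sum.cong refl) (simp add: c_def f_def g_def c_coef_def power_add ac_simps)
  also have "\<dots> = (\<Sum>i\<le>l. \<Sum>r\<le>l. \<Sum>j\<le>l. ?w * (c r * (f r j * g r i)))"
    by (intro sum.cong refl sum.swap)
  also have "\<dots> = (\<Sum>r\<le>l. \<Sum>i\<le>l. \<Sum>j\<le>l. ?w * (c r * (f r j * g r i)))"
    by (rule sum.swap)
  also have "\<dots> = (\<Sum>r\<le>l. \<Sum>j\<le>l. \<Sum>i\<le>l. ?w * (c r * (f r j * g r i)))"
    by (intro sum.cong refl sum.swap)
  also have "\<dots> = ?w * (\<Sum>r\<le>l. c r * ((\<Sum>j\<le>l. f r j) * (\<Sum>i\<le>l. g r i)))"
    unfolding sum_product unfolding sum_distrib_left ..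
  also have "\<dots> = weighted (form_density (vec_index F) (conj_fun (vec_index G))) x"
    unfolding weighted_def poly_form_density by (simp add: poly_pascal c_def f_def g_def mult.assoc)
  finally show ?thesis .
qed

lemma orthogonal_W_iff:
  assumes "F \<in> carrier_vec (l + 1)" "G \<in> carrier_vec (l + 1)"
  shows "orthogonal_W \<alpha> \<beta> k l F G \<longleftrightarrow> inner_W (vec_index F) (conj_fun (vec_index G)) = 0"
  unfolding orthogonal_W_def weightW_form[OF assms] inner_W_def ..

end

section \<open>The hypergeometric construction for a simple eigenvalue\<close>

lemma det_triangular_nonzero:
  fixes A :: "'a::idom mat"
  assumes "A \<in> carrier_mat n n"
    and "(\<forall>i j. i < j \<and> j < n \<longrightarrow> A $$ (i, j) = 0) \<or> (\<forall>i j. j < i \<and>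
          i < n \<longrightarrow> A $$ (i, j) = 0)"
    and "\<And>i. i < n \<Longrightarrow> A $$ (i, i) \<noteq> 0"
  shows "det A \<noteq> 0"
proof -
  have "det A = prod_list (diag_mat A)"
    using assms(2)
  proof
    assume "\<forall>i j. i < j \<and> j < n \<longrightarrow> A $$ (i, j) = 0"
    then show ?thesis using det_lower_triangular[OF _ assms(1)] by blast
  next
    assume "\<forall>i j. j < i \<and> i < n \<longrightarrow> A $$ (i, j) = 0"
    then have "upper_triangular A" using assms(1) by (intro upper_triangularI) auto
    then show ?thesis using det_upper_triangular assms(1) by blast
  qed
  then show ?thesis using assms(1,3) by (auto simp: prod_list_zero_iff diag_mat_def)
qed

lemma det_nonzero_mat_inverse:
  fixes A :: "'a::field mat"
  assumes A: "A \<in> carrier_mat n n" and "det A \<noteq> 0"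
  shows "the (mat_inverse A) \<in> carrier_mat n n"
    "A * the (mat_inverse A) = 1\<^sub>m n" "the (mat_inverse A) * A = 1\<^sub>m n"
proof -
  have "A \<in> Units (ring_mat TYPE('a) n undefined)" using det_non_zero_imp_unit[OF assms] .
  then obtain B where B: "mat_inverse A = Some B" using mat_inverse(1)[OF A, of undefined] by (cases "mat_inverse A") auto
  then show "the (mat_inverse A) \<in> carrier_mat n n"
    "A * the (mat_inverse A) = 1\<^sub>m n" "the (mat_inverse A) * A = 1\<^sub>m n"
    using mat_inverse(2)[OF A B] by auto
qed

context jacobi begin

text \<open>The matrices \<open>C + i\<close> and \<open>i (U + i - 1) + V + z\<close> of the recursion for \<open>[C; U; V + z]\<close>. They are
  triangular, the first with positive diagonal, the second with diagonal \<open>z - \<lambda>\<^sub>r(i)\<close>.\<close>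

definition C_shift :: "nat \<Rightarrow> complex mat" where
  "C_shift i = matC \<beta> l + of_nat i \<cdot>\<^sub>m 1\<^sub>m (l + 1)"

definition V_shift :: "complex \<Rightarrow> nat \<Rightarrow> complex mat" where
  "V_shift z i = of_nat i \<cdot>\<^sub>m (matU \<alpha> \<beta> l + (of_nat i - 1) \<cdot>\<^sub>m 1\<^sub>m (l + 1)) +
        (matV \<alpha> \<beta> k l + z \<cdot>\<^sub>m 1\<^sub>m (l + 1))"

lemma shift_carrier [simp]:
  "C_shift i \<in> carrier_mat (l + 1) (l + 1)" "V_shift z i \<in> carrier_mat (l + 1) (l + 1)"
  by (simp_all add: C_shift_def V_shift_def matC_def matU_def matV_def real_mat_def)

lemma C_shift_index:
  assumes "r < l + 1" "s < l + 1"
  shows "C_shift i $$ (r, s) = (if s = r then of_real (\<beta> + 1 + 2 * real r + real i) else if r = s + 1 then of_nat r else 0)"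
  using assms by (auto simp: C_shift_def matC_def real_mat_def)

lemma V_shift_index:
  assumes "r < l + 1" "s < l + 1"
  shows "V_shift z i $$ (r, s) = (if s = r then z - of_real (lam \<alpha> \<beta> k l r i)
     else if s = r + 1 then - of_real ((real l - real r) * (\<beta> - k + 1 + real r)) else 0)"
  using assms by (auto simp: V_shift_def matU_def matV_def real_mat_def lam_def algebra_simps)

lemma det_C_shift: "det (C_shift i) \<noteq> 0"
proof (rule det_triangular_nonzero[OF shift_carrier(1)])
  fix r assume r: "r < l + 1"
  have "\<beta> + 1 + 2 * real r + real i > 0" using beta by simp
  then have "complex_of_real (\<beta> + 1 + 2 * real r + real i) \<noteq> 0" unfolding of_real_eq_0_iff by linarith
  then show "C_shift i $$ (r, r) \<noteq> 0" using C_shift_index[OF r r] by simp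
next
  show "(\<forall>r s. r < s \<and> s < l + 1 \<longrightarrow> C_shift i $$ (r, s) = 0) \<or> (\<forall>r s. s < r \<and>
        r < l + 1 \<longrightarrow> C_shift i $$ (r, s) = 0)"
    by (rule disjI1) (simp add: C_shift_index)
qed

lemma det_V_shift:
  assumes "\<And>r. r \<le> l \<Longrightarrow> z \<noteq> of_real (lam \<alpha> \<beta> k l r i)"
  shows "det (V_shift z i) \<noteq> 0"
proof (rule det_triangular_nonzero[OF shift_carrier(2)])
  fix r assume r: "r < l + 1"
  then show "V_shift z i $$ (r, r) \<noteq> 0" using V_shift_index[OF r r] assms[of r] by simp
next
  show "(\<forall>r s. r < s \<and> s < l + 1 \<longrightarrow> V_shift z i $$ (r, s) = 0) \<or> (\<forall>r s. s < r \<and>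
        r < l + 1 \<longrightarrow> V_shift z i $$ (r, s) = 0)"
    by (rule disjI2) (simp add: V_shift_index)
qed

lemma CUV_0: "CUV \<alpha> \<beta> k l z 0 = 1\<^sub>m (l + 1)"
  by (simp add: CUV_def matC_def real_mat_def)

lemma CUV_Suc: "CUV \<alpha> \<beta> k l z (Suc i) = the (mat_inverse (C_shift i)) * V_shift z i * CUV \<alpha> \<beta> k l z i"
  by (simp add: CUV_def matC_def real_mat_def C_shift_def V_shift_def)

lemma CUV_carrier [simp]: "CUV \<alpha> \<beta> k l z i \<in> carrier_mat (l + 1) (l + 1)"
proof (induction i)
  case (Suc i)
  then show ?case unfolding CUV_Suc
    using det_nonzero_mat_inverse(1)[OF shift_carrier(1) det_C_shift] shift_carrier(2) by (meson mult_carrier_mat)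
qed (simp add: CUV_0)

lemma C_shift_CUV_Suc: "C_shift i * CUV \<alpha> \<beta> k l z (Suc i) = V_shift z i * CUV \<alpha> \<beta> k l z i"
proof -
  note inv = det_nonzero_mat_inverse[OF shift_carrier(1) det_C_shift, of i]
  let ?B = "the (mat_inverse (C_shift i))" and ?X = "V_shift z i * CUV \<alpha> \<beta> k l z i"
  have X: "?X \<in> carrier_mat (l + 1) (l + 1)" by (rule mult_carrier_mat[OF shift_carrier(2) CUV_carrier])
  have "CUV \<alpha> \<beta> k l z (Suc i) = ?B * ?X"
    unfolding CUV_Suc by (rule assoc_mult_mat[OF inv(1) shift_carrier(2) CUV_carrier])
  then have "C_shift i * CUV \<alpha> \<beta> k l z (Suc i) = (C_shift i * ?B) * ?X"
    using assoc_mult_mat[OF shift_carrier(1) inv(1) X] by simp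
  then show ?thesis using inv(2) X by (simp add: left_mult_one_mat)
qed

lemma det_CUV:
  assumes "\<And>i r. i < w \<Longrightarrow> r \<le> l \<Longrightarrow> z \<noteq> of_real (lam \<alpha> \<beta> k l r i)"
  shows "det (CUV \<alpha> \<beta> k l z w) \<noteq> 0"
  using assms
proof (induction w)
  case (Suc w)
  have "det (C_shift w) * det (CUV \<alpha> \<beta> k l z (Suc w)) = det (V_shift z w) * det (CUV \<alpha> \<beta> k l z w)"
    using C_shift_CUV_Suc[of w z] det_mult[OF shift_carrier(1) CUV_carrier] det_mult[OF shift_carrier(2) CUV_carrier]
    by metis
  moreover have "det (CUV \<alpha> \<beta> k l z w) \<noteq> 0" using Suc by simp
  moreover have "det (V_shift z w) \<noteq> 0" using Suc.prems by (intro det_V_shift) simp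
  ultimately show ?case by auto
qed (simp add: CUV_0)

lemma not_repeatedD:
  assumes "not_repeated \<alpha> \<beta> k l w j" "j' \<le> l" "lam \<alpha> \<beta> k l j' w' = lam \<alpha> \<beta> k l j w"
  shows "w' = w \<and> j' = j"
proof -
  have "j' \<le> l \<and> (w', j') \<noteq> (w, j) \<longrightarrow> lam \<alpha> \<beta> k l j' w' \<noteq> lam \<alpha> \<beta> k l j w"
    using assms(1) unfolding not_repeated_def by (elim allE)
  then show ?thesis using assms(2,3) by simp
qed

text \<open>For a simple eigenvalue \<open>\<lambda>\<^sub>j(w)\<close> no factor of \<open>[C; U; V + \<lambda>]\<^sub>w\<close> is singular, as the factors are
  those with index \<open>i < w\<close>. Hence the description that defines \<open>F\<^sub>0\<close> has a unique solution.\<close>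

lemma F0_vec_carrier:
  assumes "not_repeated \<alpha> \<beta> k l w j"
  shows "F0_vec \<alpha> \<beta> k l w j \<in> carrier_vec (l + 1)"
proof -
  let ?A = "CUV \<alpha> \<beta> k l (complex_of_real (lam \<alpha> \<beta> k l j w)) w"
  let ?b = "rhs_vec \<alpha> \<beta> k l w j"
  have "complex_of_real (lam \<alpha> \<beta> k l j w) \<noteq> of_real (lam \<alpha> \<beta> k l r i)" if "i < w" "r \<le> l" for i r
  proof -
    have "lam \<alpha> \<beta> k l r i \<noteq> lam \<alpha> \<beta> k l j w" using not_repeatedD[OF assms that(2)] that(1) by blast
    then show ?thesis unfolding of_real_eq_iff by metis
  qed
  then have "det ?A \<noteq> 0" by (rule det_CUV)
  note inv = det_nonzero_mat_inverse[OF CUV_carrier this]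
  let ?B = "the (mat_inverse ?A)"
  have b: "?b \<in> carrier_vec (l + 1)" by (simp add: rhs_vec_def)
  have "\<exists>!F0. F0 \<in> carrier_vec (l + 1) \<and> ?A *\<^sub>v F0 = ?b"
  proof (rule ex1I[of _ "?B *\<^sub>v ?b"])
    have "?A *\<^sub>v (?B *\<^sub>v ?b) = (?A * ?B) *\<^sub>v ?b"
      by (rule assoc_mult_mat_vec[symmetric, OF CUV_carrier inv(1) b])
    also have "\<dots> = ?b" unfolding inv(2) using b by (rule one_mult_mat_vec)
    finally show "?B *\<^sub>v ?b \<in> carrier_vec (l + 1) \<and> ?A *\<^sub>v (?B *\<^sub>v ?b) = ?b"
      using mult_mat_vec_carrier[OF inv(1) b] by blast
    fix F0 assume "F0 \<in> carrier_vec (l + 1) \<and> ?A *\<^sub>v F0 = ?b"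
    then have F0: "F0 \<in> carrier_vec (l + 1)" and eq: "?A *\<^sub>v F0 = ?b" by auto
    have "?B *\<^sub>v ?b = (?B * ?A) *\<^sub>v F0"
      unfolding eq[symmetric] by (rule assoc_mult_mat_vec[symmetric, OF inv(1) CUV_carrier F0])
    also have "\<dots> = F0" unfolding inv(3) using F0 by (rule one_mult_mat_vec)
    finally show "F0 = ?B *\<^sub>v ?b" ..
  qed
  from theI'[OF this] show ?thesis unfolding F0_vec_def by blast
qed

lemma C_shift_mult_index:
  assumes v: "v \<in> carrier_vec (l + 1)" and r: "r \<le> l"
  shows "(C_shift i *\<^sub>v v) $ r = of_real (\<beta> + 1 + 2 * real r + real i) * v $ r + of_nat r * v $ (r - 1)"
proof -
  have "(C_shift i *\<^sub>v v) $ r = (\<Sum>s<l + 1. if s = r then of_real (\<beta> + 1 + 2 * real r + real i) * v $ s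
      else if r = s + 1 then of_nat r * v $ s else if s = r + 1 then 0 else 0)"
    using v r shift_carrier(1)[of i]
    by (subst index_mult_mat_vec) (auto simp: scalar_prod_def atLeast0LessThan C_shift_index intro!: sum.cong simp del: sum.lessThan_Suc)
  then show ?thesis unfolding sum_tridiagonal[OF r] by auto
qed

lemma V_shift_mult_index:
  assumes v: "v \<in> carrier_vec (l + 1)" and r: "r \<le> l"
  shows "(V_shift z i *\<^sub>v v) $ r = (z - of_real (lam \<alpha> \<beta> k l r i)) * v $ r
     - of_real ((real l - real r) * (\<beta> - k + 1 + real r)) * (if r = l then 0 else v $ (r + 1))"
proof -
  have "(V_shift z i *\<^sub>v v) $ r = (\<Sum>s<l + 1. if s = r then (z - of_real (lam \<alpha> \<beta> k l r i)) * v $ s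
      else if r = s + 1 then 0 else if s = r + 1 then - of_real ((real l - real r) * (\<beta> - k + 1 + real r)) * v $ s else 0)"
    using v r shift_carrier(2)[of z i]
    by (subst index_mult_mat_vec) (auto simp: scalar_prod_def atLeast0LessThan V_shift_index intro!: sum.cong simp del: sum.lessThan_Suc)
  then show ?thesis unfolding sum_tridiagonal[OF r] by auto
qed

text \<open>The recursion for \<open>[C; U; V + \<lambda>]\<close> is the coefficientwise form of \<open>D P = \<lambda> P\<close>.\<close>

lemma hyp_poly_eigenfun:
  assumes nr: "not_repeated \<alpha> \<beta> k l w j" and P: "hyp_poly \<alpha> \<beta> k l w j P"
  shows "eigenfun (lam \<alpha> \<beta> k l j w) (vec_index P)"
  unfolding eigenfun_def
proof (intro allI impI)
  fix r assume r: "r \<le> l"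
  define z where "z = complex_of_real (lam \<alpha> \<beta> k l j w)"
  let ?F0 = "F0_vec \<alpha> \<beta> k l w j"
  have F0: "?F0 \<in> carrier_vec (l + 1)" by (rule F0_vec_carrier[OF nr])
  have Pc: "P \<in> carrier_vec (l + 1)" using P by (simp add: hyp_poly_def)
  define v where "v = (\<lambda>i. map_vec (\<lambda>p. coeff p i) P)"
  have v: "v i \<in> carrier_vec (l + 1)" for i using Pc by (simp add: v_def)
  have vi: "v i $ s = coeff (P $ s) i" if "s \<le> l" for i s using Pc that by (simp add: v_def)
  have veq: "v i = (1 / fact i) \<cdot>\<^sub>v (CUV \<alpha> \<beta> k l z i *\<^sub>v ?F0)" for i
    using P unfolding hyp_poly_def v_def z_def by blast
  have rec: "of_nat (Suc i) * (C_shift i *\<^sub>v v (Suc i)) $ r = (V_shift z i *\<^sub>v v i) $ r" for i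
  proof -
    have c: "CUV \<alpha> \<beta> k l z i *\<^sub>v ?F0 \<in> carrier_vec (l + 1)" for i
      by (rule mult_mat_vec_carrier[OF CUV_carrier F0])
    have eq: "C_shift i *\<^sub>v (CUV \<alpha> \<beta> k l z (Suc i) *\<^sub>v ?F0) =
          V_shift z i *\<^sub>v (CUV \<alpha> \<beta> k l z i *\<^sub>v ?F0)"
      using C_shift_CUV_Suc[of i z] assoc_mult_mat_vec[OF shift_carrier(1) CUV_carrier F0]
        assoc_mult_mat_vec[OF shift_carrier(2) CUV_carrier F0] by metis
    have "C_shift i *\<^sub>v v (Suc i) = (1 / fact (Suc i)) \<cdot>\<^sub>v (V_shift z i *\<^sub>v (CUV \<alpha> \<beta> k l z i *\<^sub>v ?F0))"
      unfolding veq eq[symmetric] by (rule mult_mat_vec[OF shift_carrier(1) c])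
    moreover have "V_shift z i *\<^sub>v v i = (1 / fact i) \<cdot>\<^sub>v (V_shift z i *\<^sub>v (CUV \<alpha> \<beta> k l z i *\<^sub>v ?F0))"
      unfolding veq by (rule mult_mat_vec[OF shift_carrier(2) c])
    moreover have "V_shift z i *\<^sub>v (CUV \<alpha> \<beta> k l z i *\<^sub>v ?F0) \<in> carrier_vec (l + 1)"
      by (rule mult_mat_vec_carrier[OF shift_carrier(2) c])
    then have "dim_vec (V_shift z i *\<^sub>v (CUV \<alpha> \<beta> k l z i *\<^sub>v ?F0)) = l + 1"
      by (rule carrier_vecD)
    ultimately show ?thesis using r by (simp add: field_simps del: of_nat_Suc index_mult_mat_vec)
  qed
  show "rowD (vec_index P) r = cst (lam \<alpha> \<beta> k l j w) * P $ r"
  proof (rule poly_eqI)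
    fix i
    have "of_nat (Suc i) * (of_real (\<beta> + 1 + 2 * real r + real i) * coeff (P $ r) (Suc i) + of_nat r * coeff (P $ (r - 1)) (Suc i))
        = (z - of_real (lam \<alpha> \<beta> k l r i)) * coeff (P $ r) i
         - of_real ((real l - real r) * (\<beta> - k + 1 + real r)) * (if r = l then 0 else coeff (P $ (r + 1)) i)"
      using rec[of i] r unfolding C_shift_mult_index[OF v r] V_shift_mult_index[OF v r] by (auto simp: vi)
    then show "coeff (rowD (vec_index P) r) i = coeff (cst (lam \<alpha> \<beta> k l j w) * P $ r) i"
      unfolding coeff_rowD coeff_cst_mult D_coeff_def z_def lam_def
      by (cases "r = l") (simp_all add: algebra_simps)
  qed
qed

end

section \<open>The constructed vectors are eigenfunctions of \<open>E\<close>\<close>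

lemma ex_listing_by_key:
  fixes S :: "(nat \<times> 'b) set"
  assumes "finite S" "inj_on fst S"
  shows "\<exists>ps. set ps = S \<and> sorted_wrt (\<lambda>p q. fst p < fst q) ps"
proof -
  obtain xs where xs: "set xs = S" "distinct xs" using finite_distinct_list[OF assms(1)] by blast
  let ?ps = "sort_key fst xs"
  have "distinct (map fst ?ps)" using xs assms(2) by (simp add: distinct_map)
  moreover have "sorted (map fst ?ps)" by (rule sorted_sort_key)
  ultimately have "sorted_wrt (<) (map fst ?ps)" by (simp only: strict_sorted_iff simp_thms)
  then have "sorted_wrt (\<lambda>p q. fst p < fst q) ?ps" by (simp only: sorted_wrt_map)
  moreover have "set ?ps = S" using xs by simp
  ultimately show ?thesis by blast
qed

text \<open>In the list of all pairs with a given eigenvalue, a degree smaller than \<open>w\<^sub>r\<close> is at most \<open>w\<^sub>r\<^sub>-\<^sub>1\<close>.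
  So degree less than \<open>w\<^sub>r\<close> means membership in \<open>V\<^sub>r\<^sub>-\<^sub>1\<close>.\<close>

lemma sorted_listing_predecessor:
  assumes s: "sorted_wrt (\<lambda>p q. fst p < fst q) ps" and x: "x \<in> set ps" and m: "m < length ps"
    and less: "fst x < (fst (ps ! m) :: nat)"
  shows "m \<ge> 1 \<and> fst x \<le> fst (ps ! (m - 1))"
proof -
  obtain i where i: "i < length ps" "x = ps ! i" using x by (metis in_set_conv_nth)
  have lt: "fst (ps ! a) < fst (ps ! b)" if "a < b" "b < length ps" for a b
    using sorted_wrt_nth_less[OF s that] .
  have "i < m"
  proof (rule ccontr)
    assume "\<not> i < m"
    then have "i = m \<or> m < i" by linarith
    then show False using lt[of m i] i less by auto
  qed
  then have m1: "m \<ge> 1" "m - 1 < length ps" and "i = m - 1 \<or> i < m - 1" using m by linarith+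
  from this(3) have "fst x \<le> fst (ps ! (m - 1))"
    using lt[OF _ m1(2)] i(2) less_imp_le by blast
  then show ?thesis using m1(1) by blast
qed

context jacobi_params begin

lemma opD_carrier: "P \<in> carrier_vec (l + 1) \<Longrightarrow> opD \<alpha> \<beta> k l P \<in> carrier_vec (l + 1)"
  by (rule carrier_vecI) (simp add: opD_def const_mat_def matV_def real_mat_def)

lemma eigenspace_iff:
  "P \<in> eigenspace \<alpha> \<beta> k l (complex_of_real z) \<longleftrightarrow> P \<in> carrier_vec (l + 1) \<and>
        eigenfun z (vec_index P)"
proof -
  have "opD \<alpha> \<beta> k l P = [:complex_of_real z:] \<cdot>\<^sub>v P \<longleftrightarrow> eigenfun z (vec_index P)" if P: "P \<in> carrier_vec (l + 1)"
  proof
    assume eq: "opD \<alpha> \<beta> k l P = [:complex_of_real z:] \<cdot>\<^sub>v P"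
    show "eigenfun z (vec_index P)"
      unfolding eigenfun_def
    proof (intro allI impI)
      fix i assume i: "i \<le> l"
      have "rowD (vec_index P) i = ([:complex_of_real z:] \<cdot>\<^sub>v P) $ i"
        using opD_index[OF P i] eq by simp
      also have "\<dots> = cst z * P $ i" using P i by (simp add: cst_def)
      finally show "rowD (vec_index P) i = cst z * P $ i" .
    qed
  next
    assume e: "eigenfun z (vec_index P)"
    show "opD \<alpha> \<beta> k l P = [:complex_of_real z:] \<cdot>\<^sub>v P"
    proof (rule eq_vecI)
      show "dim_vec (opD \<alpha> \<beta> k l P) = dim_vec ([:complex_of_real z:] \<cdot>\<^sub>v P)"
        using opD_carrier[OF P] P by simp
      fix i assume "i < dim_vec ([:complex_of_real z:] \<cdot>\<^sub>v P)"
      then have i: "i \<le> l" using P by simp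
      then show "opD \<alpha> \<beta> k l P $ i = ([:complex_of_real z:] \<cdot>\<^sub>v P) $ i"
        using opD_index[OF P i] e P by (simp add: eigenfun_def cst_def)
    qed
  qed
  then show ?thesis unfolding eigenspace_def by blast
qed

lemma eigenfun_cong:
  assumes "\<And>i. i \<le> l \<Longrightarrow> F i = G i"
  shows "eigenfun z F \<longleftrightarrow> eigenfun z G"
  unfolding eigenfun_def using rowD_cong[OF _ assms] assms by auto

lemma leading_at_degree: "leading_at F w j \<Longrightarrow> i \<le> l \<Longrightarrow> degree (F i) \<le> w"
  using leading_at_vanish by (intro degree_le) blast

end

context jacobi begin

text \<open>The difference is \<open>(i - j) (w + i + j + \<alpha> + \<beta> - k + 1)\<close> up to sign, and the second factor is positive
  if \<open>i \<noteq> j\<close>, as \<open>i + j \<ge> 1\<close>, \<open>\<alpha> > -1\<close> and \<open>k < \<beta> + 1\<close>.\<close>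

lemma lam_inj:
  assumes "lam \<alpha> \<beta> k l i w = lam \<alpha> \<beta> k l j w"
  shows "i = j"
proof -
  have "(real i - real j) * (real w + real i + real j + \<alpha> + \<beta> - k + 1) = 0"
    using assms unfolding lam_def by (simp add: algebra_simps)
  moreover have "real w + real i + real j + \<alpha> + \<beta> - k + 1 > 0" if "i \<noteq> j"
  proof -
    have "real i + real j \<ge> 1" using that by linarith
    then show ?thesis using alpha k_less by linarith
  qed
  ultimately show ?thesis by force
qed

text \<open>This bound leaves only finitely many pairs with a given eigenvalue, so that they can be listed.\<close>

lemma lam_le: "lam \<alpha> \<beta> k l j w \<le> - real w"
proof -
  have "real w * 1 \<le> real w * (real w + \<alpha> + \<beta> + real l + real j + 1)"
  proof (cases "w = 0")
    case False
    then have "1 \<le> real w" "1 \<le> real l" using l_pos by auto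
    then have "1 \<le> real w + \<alpha> + \<beta> + real l + real j + 1" using alpha beta by linarith
    then show ?thesis by (intro mult_left_mono) auto
  qed simp
  moreover have "0 \<le> real j * (real j + \<alpha> + \<beta> - k + 1)"
  proof (cases "j = 0")
    case False
    then have "1 \<le> real j" by simp
    then show ?thesis using alpha k_less by (intro mult_nonneg_nonneg) linarith+
  qed simp
  ultimately show ?thesis unfolding lam_def by linarith
qed

lemma listing_exists: "\<exists>ps. pair_listing \<alpha> \<beta> k l z ps"
proof -
  let ?S = "{(w, j). j \<le> l \<and> lam \<alpha> \<beta> k l j w = z}"
  have "?S \<subseteq> {..nat \<lceil>- z\<rceil>} \<times> {..l}"
  proof
    fix x assume "x \<in> ?S"
    then obtain w j where x: "x = (w, j)" "j \<le> l" "lam \<alpha> \<beta> k l j w = z" by auto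
    then have "real w \<le> - z" using lam_le[of j w] by linarith
    then have "w \<le> nat \<lceil>- z\<rceil>" by linarith
    then show "x \<in> {..nat \<lceil>- z\<rceil>} \<times> {..l}" using x by simp
  qed
  then have "finite ?S" by (rule finite_subset) simp
  moreover have "inj_on fst ?S" using lam_inj by (intro inj_onI) fastforce
  ultimately show ?thesis unfolding pair_listing_def by (rule ex_listing_by_key)
qed

text \<open>The difference \<open>E F - \<mu>\<^sub>j(w) F\<close>, written in the form of a linear combination for which linearity has been
  stated.\<close>

definition eigen_defect :: "nat \<Rightarrow> nat \<Rightarrow> (nat \<Rightarrow> complex poly) \<Rightarrow> nat \<Rightarrow> complex poly" where
  "eigen_defect w j F = (\<lambda>i. cst 1 * rowE F i + cst (- mu \<alpha> \<beta> k l j w) * F i)"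

text \<open>Passing to the defect removes the coefficient at the leading position \<open>(w, j)\<close>. The defect cannot lead at another
  component in degree \<open>w\<close>, because that component would have the same eigenvalue.\<close>

lemma eigen_defect_leading:
  assumes F: "eigenfun z F" "leading_at F w j" and j: "lam \<alpha> \<beta> k l j w = z"
    and r: "leading_at (eigen_defect w j F) w1 j1" "coeff (eigen_defect w j F j1) w1 \<noteq> 0"
  shows "lam \<alpha> \<beta> k l j1 w1 = z" "j1 \<le> l" "w1 < w"
proof -
  have er: "eigenfun z (eigen_defect w j F)"
    unfolding eigen_defect_def by (intro eigenfun_lincomb eigenfun_rowE F(1))
  show l1: "lam \<alpha> \<beta> k l j1 w1 = z" by (rule eigenfun_leading[OF er r])
  show j1: "j1 \<le> l" using r(1) by (simp add: leading_at_def)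
  have "degree (eigen_defect w j F j1) \<le> w"
    unfolding eigen_defect_def using degree_rowE_le[OF leading_at_degree[OF F(2)] j1] leading_at_degree[OF F(2) j1]
    by (intro degree_add_le order.trans[OF degree_mult_le]) (simp_all add: cst_def)
  then have "w1 \<le> w" using le_degree[OF r(2)] by simp
  moreover have "w1 \<noteq> w"
  proof
    assume w1: "w1 = w"
    have "j1 = j" using l1 j unfolding w1 by (intro lam_inj[of _ w]) simp
    then have "coeff (eigen_defect w j F j1) w1 = 0"
      using coeff_rowE_leading[OF F(2)] w1 by (simp add: eigen_defect_def coeff_cst_mult)
    then show False using r(2) by simp
  qed
  ultimately show "w1 < w" by simp
qed

lemma inner_W_cong:
  assumes "\<And>i. i \<le> l \<Longrightarrow> F i = F' i" "\<And>i. i \<le> l \<Longrightarrow> G i = G' i"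
  shows "inner_W F G = inner_W F' G'"
proof -
  have "pascal F = pascal F'" "pascal G = pascal G'" unfolding pascal_def using assms by (auto intro!: ext sum.cong)
  then show ?thesis unfolding inner_W_def form_density_def by simp
qed

lemma V_sub_iff:
  "r \<ge> 1 \<Longrightarrow> P \<in> V_sub \<alpha> \<beta> k l z ps r \<longleftrightarrow>
     P \<in> carrier_vec (l + 1) \<and> eigenfun z (vec_index P) \<and> (\<forall>i\<le>l. degree (P $ i) \<le> fst (ps ! (r - 1)))"
  unfolding V_sub_def using eigenspace_iff by (auto simp: less_Suc_eq_le)

text \<open>First \<open>P\<^sub>r\<close> has degree exactly \<open>w\<^sub>r\<close>: otherwise it would lie in \<open>V\<^sub>r\<^sub>-\<^sub>1\<close> and be orthogonal to itself.
  Then its defect \<open>q\<close> and \<open>E q\<close> lie in \<open>V\<^sub>r\<^sub>-\<^sub>1\<close>, so \<open>\<langle>q, q\<rangle> = 0\<close> by symmetry of \<open>E\<close>. The list position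
  \<open>m\<close> is \<open>r - 1\<close>.\<close>

lemma constructed_in_repeated_case:
  assumes fam: "constructed_family \<alpha> \<beta> k l p" and listing: "pair_listing \<alpha> \<beta> k l z ps"
    and len: "length ps \<ge> 2" and m: "m < length ps" and psm: "ps ! m = (w, j)" and i: "i \<le> l"
  shows "rowE (vec_index (p w j)) i = cst (mu \<alpha> \<beta> k l j w) * p w j $ i"
proof -
  define F where "F = vec_index (p w j)"
  have sorted: "sorted_wrt (\<lambda>p q. fst p < fst q) ps"
    and set_ps: "set ps = {(w, j). j \<le> l \<and> lam \<alpha> \<beta> k l j w = z}"
    using listing unfolding pair_listing_def by auto
  have wj: "j \<le> l" "lam \<alpha> \<beta> k l j w = z" using nth_mem[OF m] psm set_ps by auto
  have "\<forall>r \<in> {1..length ps}. let (w, j) = ps ! (r - 1) in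
           p w j \<in> V_sub \<alpha> \<beta> k l z ps r \<and> p w j \<noteq> 0\<^sub>v (l + 1) \<and>
             (\<forall>Q \<in> V_sub \<alpha> \<beta> k l z ps (r - 1). orthogonal_W \<alpha> \<beta> k l (p w j) Q)"
    using fam listing len unfolding constructed_family_def by blast
  from bspec[OF this, of "m + 1"] have pV: "p w j \<in> V_sub \<alpha> \<beta> k l z ps (m + 1)" and p0: "p w j \<noteq> 0\<^sub>v (l + 1)"
    and orth: "\<And>Q. Q \<in> V_sub \<alpha> \<beta> k l z ps m \<Longrightarrow> orthogonal_W \<alpha> \<beta> k l (p w j) Q"
    using m psm by auto
  have pc: "p w j \<in> carrier_vec (l + 1)" and eF: "eigenfun z F" and degF: "\<And>i. i \<le> l \<Longrightarrow> degree (F i) \<le> w"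
    using pV psm unfolding V_sub_iff[OF le_add2] F_def by auto
  have in_V: "m \<ge> 1 \<and> vec (l + 1) G \<in> V_sub \<alpha> \<beta> k l z ps m"
    if "eigenfun z G" "\<And>i. i \<le> l \<Longrightarrow> degree (G i) \<le> w1" "lam \<alpha> \<beta> k l j1 w1 =
          z" "j1 \<le> l" "w1 < w" for G w1 j1
  proof -
    have "(w1, j1) \<in> set ps" using that(3,4) set_ps by simp
    then have pred: "m \<ge> 1 \<and> w1 \<le> fst (ps ! (m - 1))"
      using sorted_listing_predecessor[OF sorted _ m, of "(w1, j1)"] that(5) psm by simp
    then have "\<forall>i\<le>l. degree (vec (l + 1) G $ i) \<le> fst (ps ! (m - 1))"
      using that(2) order.trans by fastforce
    moreover have "eigenfun z (vec_index (vec (l + 1) G))"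
      using that(1) by (subst eigenfun_cong[of _ G]) auto
    ultimately show ?thesis using pred V_sub_iff by simp
  qed
  have orth': "inner_W F (conj_fun G) = 0"
    if "eigenfun z G" "\<And>i. i \<le> l \<Longrightarrow> degree (G i) \<le> w1" "lam \<alpha> \<beta> k l j1 w1 =
          z" "j1 \<le> l" "w1 < w" for G w1 j1
  proof -
    have "orthogonal_W \<alpha> \<beta> k l (p w j) (vec (l + 1) G)" using in_V[OF that] orth by blast
    then have "inner_W F (conj_fun (vec_index (vec (l + 1) G))) = 0"
      using orthogonal_W_iff[OF pc, of "vec (l + 1) G"] by (simp add: F_def)
    then show ?thesis using inner_W_cong[of F F "conj_fun (vec_index (vec (l + 1) G))" "conj_fun G"] by simp
  qed
  have "\<exists>i\<le>l. F i \<noteq> 0"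
  proof (rule ccontr)
    assume "\<not> (\<exists>i\<le>l. F i \<noteq> 0)"
    then have "p w j = 0\<^sub>v (l + 1)" using pc by (intro eq_vecI) (auto simp: F_def)
    then show False using p0 by simp
  qed
  then obtain w' j' where lead: "leading_at F w' j'" "coeff (F j') w' \<noteq> 0" by (rule leading_exists)
  have j': "j' \<le> l" using lead(1) by (simp add: leading_at_def)
  have lam': "lam \<alpha> \<beta> k l j' w' = z" by (rule eigenfun_leading[OF eF lead])
  have "w' = w"
  proof (rule ccontr)
    assume "w' \<noteq> w"
    then have "w' < w" using degF[OF j'] le_degree[OF lead(2)] by simp
    have "inner_W F (conj_fun F) = 0"
      by (rule orth'[OF eF leading_at_degree[OF lead(1)] lam' j' \<open>w' < w\<close>])
    then have "F j' = 0" using j' by (rule inner_W_definite)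
    then show False using lead(2) by simp
  qed
  then have "lam \<alpha> \<beta> k l j' w = lam \<alpha> \<beta> k l j w" using lam' wj(2) by simp
  then have "j' = j" by (rule lam_inj)
  with \<open>w' = w\<close> have leadF: "leading_at F w j" using lead(1) by simp
  define q where "q = eigen_defect w j F"
  have eq: "eigenfun z q"
    unfolding q_def eigen_defect_def by (intro eigenfun_lincomb eigenfun_rowE eF)
  have "q i = 0" if i: "i \<le> l" for i
  proof (rule ccontr)
    assume "q i \<noteq> 0"
    then have "\<exists>i\<le>l. q i \<noteq> 0" using i by blast
    then obtain w1 j1 where q1: "leading_at q w1 j1" "coeff (q j1) w1 \<noteq> 0" by (rule leading_exists)
    note r = eigen_defect_leading[OF eF leadF wj(2) q1[unfolded q_def]]
    have "inner_W F (conj_fun q) = 0" by (rule orth'[OF eq leading_at_degree[OF q1(1)] r])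
    moreover have "inner_W F (conj_fun (rowE q)) = 0"
      by (rule orth'[OF eigenfun_rowE[OF eq] degree_rowE_le[OF leading_at_degree[OF q1(1)]] r])
    moreover have "inner_W (rowE F) (conj_fun q) = inner_W F (conj_fun (rowE q))"
      unfolding inner_W_rowE using rowE_conj[of q] by (intro inner_W_cong) simp_all
    moreover have "inner_W q (conj_fun q) = of_real 1 * inner_W (rowE F) (conj_fun q)
        + of_real (- mu \<alpha> \<beta> k l j w) * inner_W F (conj_fun q)"
      by (subst (1) q_def) (simp only: eigen_defect_def inner_W_lincomb)
    ultimately have "inner_W q (conj_fun q) = 0" by simp
    then have "q i = 0" using i by (rule inner_W_definite)
    then show False using \<open>q i \<noteq> 0\<close> by simp
  qed
  from this[OF i] show ?thesis
    by (simp add: q_def eigen_defect_def F_def cst_hom)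
qed

text \<open>A nonzero defect would provide a second pair with the same eigenvalue.\<close>

lemma constructed_in_simple_case:
  assumes nr: "not_repeated \<alpha> \<beta> k l w j" and j: "j \<le> l" and hyp: "hyp_poly \<alpha> \<beta> k l w j P" and i: "i \<le> l"
  shows "rowE (vec_index P) i = cst (mu \<alpha> \<beta> k l j w) * P $ i"
proof (rule ccontr)
  let ?z = "lam \<alpha> \<beta> k l j w"
  assume "rowE (vec_index P) i \<noteq> cst (mu \<alpha> \<beta> k l j w) * P $ i"
  then have qi: "eigen_defect w j (vec_index P) i \<noteq> 0" by (simp add: eigen_defect_def cst_hom)
  have e: "eigenfun ?z (vec_index P)" by (rule hyp_poly_eigenfun[OF nr hyp])
  have "\<exists>i\<le>l. P $ i \<noteq> 0"
  proof (rule ccontr)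
    assume zero: "\<not> (\<exists>i\<le>l. P $ i \<noteq> 0)"
    then have "rowE (vec_index P) i = rowE (\<lambda>_. 0) i" using i by (intro rowE_cong) auto
    then show False using qi zero i by (simp add: eigen_defect_def rowE_def)
  qed
  then obtain w' j' where lead: "leading_at (vec_index P) w' j'" "coeff (P $ j') w' \<noteq> 0" by (rule leading_exists)
  have "j' \<le> l" using lead(1) by (simp add: leading_at_def)
  then have "leading_at (vec_index P) w j"
    using not_repeatedD[OF nr _ eigenfun_leading[OF e lead]] lead(1) by simp
  note lead_P = this
  have "\<exists>i\<le>l. eigen_defect w j (vec_index P) i \<noteq> 0" using qi i by blast
  then obtain w1 j1 where "leading_at (eigen_defect w j (vec_index P)) w1 j1" "coeff (eigen_defect w j (vec_index P) j1) w1 \<noteq> 0"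
    by (rule leading_exists)
  note r = eigen_defect_leading[OF e lead_P refl this]
  show False using not_repeatedD[OF nr r(2) r(1)] r(3) by simp
qed

lemma constructed_eigenfunction:
  assumes fam: "constructed_family \<alpha> \<beta> k l p" and j: "j \<le> l" and i: "i \<le> l"
  shows "rowE (vec_index (p w j)) i = cst (mu \<alpha> \<beta> k l j w) * p w j $ i"
proof (cases "not_repeated \<alpha> \<beta> k l w j")
  case True
  then have "hyp_poly \<alpha> \<beta> k l w j (p w j)" using fam j unfolding constructed_family_def by blast
  then show ?thesis by (rule constructed_in_simple_case[OF True j _ i])
next
  case False
  define z where "z = lam \<alpha> \<beta> k l j w"
  obtain ps where ps: "pair_listing \<alpha> \<beta> k l z ps" using listing_exists by blast
  then have set_ps: "set ps = {(w, j). j \<le> l \<and> lam \<alpha> \<beta> k l j w = z}" by (simp add: pair_listing_def)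
  then have mem: "(w, j) \<in> set ps" using j by (simp add: z_def)
  obtain w' j' where "j' \<le> l" "(w', j') \<noteq> (w, j)" "lam \<alpha> \<beta> k l j' w' = z"
    using False unfolding not_repeated_def z_def by blast
  then have "(w', j') \<in> set ps" "(w', j') \<noteq> (w, j)" using set_ps by simp_all
  then have len: "length ps \<ge> 2" using mem by (cases ps rule: remdups_adj.cases) auto
  obtain m where "m < length ps" "ps ! m = (w, j)" using mem by (metis in_set_conv_nth)
  then show ?thesis by (rule constructed_in_repeated_case[OF fam ps len _ _ i])
qed

end

theorem theorem5p2:
  fixes \<alpha> \<beta> k :: real and l :: nat
    and p :: "nat \<Rightarrow> nat \<Rightarrow> complex poly vec"
    and P :: "nat \<Rightarrow> complex poly mat"
  assumes "\<alpha> > -1" and "\<beta> > -1" and "0 < k" and "k < \<beta> + 1" and "l \<ge> 1"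
    and "constructed_family \<alpha> \<beta> k l p"
    and "\<And>w. P w \<in> carrier_mat (l + 1) (l + 1)"
    and "\<And>w j. j \<le> l \<Longrightarrow> col (pstar (P w)) j = p w j"
  shows "\<forall>w. opE \<alpha> \<beta> k l (pstar (P w)) = pstar (P w) * const_mat (LambdaE \<alpha> \<beta> k l w)"
proof
  fix w
  interpret jacobi \<alpha> \<beta> k l by unfold_locales (use assms in auto)
  let ?M = "pstar (P w)"
  have M: "?M \<in> carrier_mat (l + 1) (l + 1)" using assms(7)[of w] by (simp add: pstar_def)
  have entry: "?M $$ (i, j) = p w j $ i" if "i \<le> l" "j \<le> l" for i j
    using assms(8)[OF that(2), of w, symmetric] M that by simp
  have L: "const_mat (LambdaE \<alpha> \<beta> k l w) \<in> carrier_mat (l + 1) (l + 1)"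
    by (simp add: const_mat_def LambdaE_def mat_diag_def)
  show "opE \<alpha> \<beta> k l ?M = ?M * const_mat (LambdaE \<alpha> \<beta> k l w)"
  proof (rule eq_matI)
    show "dim_row (opE \<alpha> \<beta> k l ?M) = dim_row (?M * const_mat (LambdaE \<alpha> \<beta> k l w))"
      "dim_col (opE \<alpha> \<beta> k l ?M) = dim_col (?M * const_mat (LambdaE \<alpha> \<beta> k l w))"
      using M L by (simp_all add: opE_def const_mat_def matQ0_def matQ1_def matP0_def matP1_def matV_def real_mat_def)
    fix i j
    assume "i < dim_row (?M * const_mat (LambdaE \<alpha> \<beta> k l w))" "j < dim_col (?M * const_mat (LambdaE \<alpha> \<beta> k l w))"
    then have i: "i \<le> l" and j: "j \<le> l" using M L by auto
    have "opE \<alpha> \<beta> k l ?M $$ (i, j) = rowE (\<lambda>m. ?M $$ (m, j)) i" by (rule opE_index[OF M i j])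
    also have "\<dots> = rowE (vec_index (p w j)) i" using entry j by (intro rowE_cong[OF i]) simp
    also have "\<dots> = cst (mu \<alpha> \<beta> k l j w) * ?M $$ (i, j)"
      using constructed_eigenfunction[OF assms(6) j i] entry[OF i j] by simp
    also have "\<dots> = (\<Sum>m<l + 1. if m = j then ?M $$ (i, m) * cst (mu \<alpha> \<beta> k l j w) else 0)"
      using j by (simp add: mult.commute del: sum.lessThan_Suc)
    also have "\<dots> = (\<Sum>m<l + 1. ?M $$ (i, m) * const_mat (LambdaE \<alpha> \<beta> k l w) $$ (m, j))"
      using j by (intro sum.cong) (auto simp: const_mat_def LambdaE_def mat_diag_def cst_def)
    also have "\<dots> = (?M * const_mat (LambdaE \<alpha> \<beta> k l w)) $$ (i, j)"
      using M L i j by (simp add: scalar_prod_def atLeast0LessThan del: sum.lessThan_Suc)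
    finally show "opE \<alpha> \<beta> k l ?M $$ (i, j) = (?M * const_mat (LambdaE \<alpha> \<beta> k l w)) $$ (i, j)" .
  qed
qed
end
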